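(* Let $d\ge1$ be an integer. For $p\in[0,+\infty)$ and $\sigma\in(0,+\infty)$ let $f_{p\sigma d}(x):=e^{ipx_1}e^{-\sigma|x|^2/2}$ for $x=(x_1,\dots,x_d)\in\mathbb R^d$. (i) Let $m,p\in[0,+\infty)$, $\sigma\in(0,+\infty)$. Then $$\|f_{p\sigma d}\|_m^2=\frac{2\,\pi^{d/2}}{\sigma^{d/2+1}\,p^{d/2-1}}\int_0^{+\infty}d\rho\;\rho^{d/2}(1+\rho^2)^m\,e^{-\frac{\rho^2+p^2}{\sigma}}\,I_{d/2-1}\Big(\frac{2p}{\sigma}\rho\Big)$$ if $p>0$, and $$\|f_{0\sigma d}\|_m^2=\frac{2\,\pi^{d/2}}{\Gamma(d/2)\,\sigma^{d}}\int_0^{+\infty}d\rho\;\rho^{d-1}(1+\rho^2)^m\,e^{-\frac{\rho^2}{\sigma}}$$ (this is the $p\to0^+$ limit of the previous formula, since $I_{d/2-1}(w)\sim\frac{(w/2)^{d/2-1}}{\Gamma(d/2)}$ for $w\to0^+$). In particular, for $m$ integer, $$\|f_{p\sigma d}\|_m^2=\pi^{d/2}\sum_{\ell=0}^m\sum_{j=0}^\ell\sum_{g=0}^j\binom{m}{\ell}\binom{\ell}{j}\binom{2j}{2g}\frac{(2g-1)!!}{2^g}\Big(\frac d2-\frac12\Big)_{\ell-j}\,p^{2j-2g}\,\sigma^{\ell+g-j-d/2}.$$ (ii) Let $\ell,m,n$ be real numbers with $0\le\ell\le m\le n$ and $m+n-\ell>d/2$. Then, for all $p,q\in[0,+\infty)$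 and $\sigma,\tau\in(0,+\infty)$, $$K_{\ell mnd}\ge\mathscr K^{F}_{\ell mnd}(p,q,\sigma,\tau):=\frac{\|f_{p+q,\sigma+\tau,d}\|_\ell}{\|f_{p\sigma d}\|_m\,\|f_{q\tau d}\|_n},$$ whence $$K_{\ell mnd}\ge\sup_{p,q\ge0,\ \sigma,\tau>0}\mathscr K^{F}_{\ell mnd}(p,q,\sigma,\tau).$$ The function $\mathscr K^{F}_{\ell mnd}$ can be computed from item (i).
   Context: The Fourier transform $\mathcal F$ is normalized so that $\mathcal F f(k)=(2\pi)^{-d/2}\int_{\mathbb R^d}e^{-ik\cdot x}f(x)\,dx$. For real $\ell\ge0$, $H^\ell(\mathbb R^d,\mathbb C)=\{f\in S'(\mathbb R^d,\mathbb C): (1+|k|^2)^{\ell/2}\mathcal F f\in L^2\}$ (with $S'$ the tempered distributions), $\|f\|_\ell=\|(1+|k|^2)^{\ell/2}\mathcal F f\|_{L^2}$. For real $0\le\ell\le m\le n$ with $m+n-\ell>d/2$, the sharp constant is $$K_{\ell mnd}:=\min\{K\in[0,+\infty):\ \|fg\|_\ell\le K\|f\|_m\|g\|_n\ \text{ for all } f\in H^m(\mathbb R^d,\mathbb C),\ g\in H^n(\mathbb R^d,\mathbb C)\}.$$ $I_\nu$ is the modified Bessel function of the first kind. Pochhammer symbol: $(a)_0=1$, $(a)_i=a(a+1)\cdots(a+i-1)$ for $i\ge1$. Double factorial: $(-1)!!=1$ and $s!!=1\cdot3\cdots(s-2)\,s$ for odd $s\ge1$. *)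

theory Defs
  imports "HOL-Analysis.Analysis" "HOL-Library.Landau_Symbols"
begin

section \<open>Schwartz functions and tempered distributions on \<open>\<real>\<^sup>d\<close>, \<open>d = CARD('d)\<close>\<close>

definition partial_deriv :: "'d::finite \<Rightarrow> (real^'d \<Rightarrow> complex) \<Rightarrow> real^'d \<Rightarrow> complex" where
  "partial_deriv i f = (\<lambda>x. frechet_derivative f (at x) (axis i 1))"

primrec partial_derivs :: "'d::finite list \<Rightarrow> (real^'d \<Rightarrow> complex) \<Rightarrow> real^'d \<Rightarrow> complex" where
  "partial_derivs [] f = f"
| "partial_derivs (i # is) f = partial_deriv i (partial_derivs is f)"

definition schwartz :: "(real^'d::finite \<Rightarrow> complex) set" where
  "schwartz = {\<phi>. \<forall>is. partial_derivs is \<phi> differentiable_on UNIV \<and>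
     (\<forall>N::nat. bounded (range (\<lambda>x. (1 + norm x) ^ N *\<^sub>R partial_derivs is \<phi> x)))}"

definition schwartz_seminorm ::
  "nat \<Rightarrow> 'd::finite list \<Rightarrow> (real^'d \<Rightarrow> complex) \<Rightarrow> real" where
  "schwartz_seminorm N is \<phi> = (SUP x. (1 + norm x) ^ N * norm (partial_derivs is \<phi> x))"

text \<open>
  A distribution is a functional on test functions; only its values on \<^const>\<open>schwartz\<close>
  matter. Continuity on the Frechet space \<^const>\<open>schwartz\<close> is domination by finitely many
  of the defining seminorms.
\<close>

type_synonym 'd distribution = "(real^'d \<Rightarrow> complex) \<Rightarrow> complex"

definition tempered :: "'d::finite distribution set" where
  "tempered = {T.
     (\<forall>\<phi>\<in>schwartz. \<forall>\<psi>\<in>schwartz. T (\<lambda>x. \<phi> x + \<psi> x) = T \<phi> + T \<psi>) \<and>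
     (\<forall>c. \<forall>\<phi>\<in>schwartz. T (\<lambda>x. c * \<phi> x) = c * T \<phi>) \<and>
     (\<exists>C N. \<forall>\<phi>\<in>schwartz.
        norm (T \<phi>) \<le> C * (\<Sum>is\<in>{is. length is \<le> N}. schwartz_seminorm N is \<phi>))}"

definition distr_of :: "(real^'d::finite \<Rightarrow> complex) \<Rightarrow> 'd distribution" where
  "distr_of f = (\<lambda>\<phi>. \<integral>x. f x * \<phi> x \<partial>lborel)"

definition distr_mult :: "(real^'d::finite \<Rightarrow> complex) \<Rightarrow> 'd distribution \<Rightarrow> 'd distribution" where
  "distr_mult a T = (\<lambda>\<phi>. T (\<lambda>k. a k * \<phi> k))"

definition fourier :: "(real^'d::finite \<Rightarrow> complex) \<Rightarrow> real^'d \<Rightarrow> complex" where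
  "fourier f k = of_real ((2 * pi) powr (- real CARD('d) / 2)) *
     (\<integral>x. exp (- (\<i> * of_real (k \<bullet> x))) * f x \<partial>lborel)"

text \<open>
  The pairing in \<^const>\<open>distr_of\<close> is bilinear, so the transpose below extends
  \<^const>\<open>fourier\<close> (no complex conjugate, no inverse transform).
\<close>

definition distr_fourier :: "'d::finite distribution \<Rightarrow> 'd distribution" where
  "distr_fourier T = (\<lambda>\<phi>. T (fourier \<phi>))"

section \<open>Sobolev spaces and the sharp constant\<close>

definition L2 :: "(real^'d::finite \<Rightarrow> complex) set" where
  "L2 = {h \<in> borel_measurable borel. integrable lborel (\<lambda>x. (norm (h x))\<^sup>2)}"

definition L2_norm :: "(real^'d::finite \<Rightarrow> complex) \<Rightarrow> real" where
  "L2_norm h = sqrt (\<integral>x. (norm (h x))\<^sup>2 \<partial>lborel)"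

definition weight :: "real \<Rightarrow> real^'d::finite \<Rightarrow> complex" where
  "weight l k = of_real ((1 + (norm k)\<^sup>2) powr (l / 2))"

definition weighted_fourier ::
  "real \<Rightarrow> 'd::finite distribution \<Rightarrow> (real^'d \<Rightarrow> complex) \<Rightarrow> bool" where
  "weighted_fourier l T h \<longleftrightarrow> h \<in> L2 \<and>
     (\<forall>\<phi>\<in>schwartz. distr_mult (weight l) (distr_fourier T) \<phi> = distr_of h \<phi>)"

definition sobolev :: "real \<Rightarrow> 'd::finite distribution set" where
  "sobolev l = {T \<in> tempered. \<exists>h. weighted_fourier l T h}"

text \<open>The \<open>L2\<close> function chosen here is unique up to null sets.\<close>

definition sobolev_norm :: "real \<Rightarrow> 'd::finite distribution \<Rightarrow> real" where
  "sobolev_norm l T = L2_norm (SOME h. weighted_fourier l T h)"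

text \<open>
  For \<open>l \<ge> 0\<close> every element of \<^term>\<open>sobolev l\<close> is a (square integrable) function; this is
  the identification under which products of elements are taken pointwise. The integrability
  condition makes the integral in \<^const>\<open>distr_of\<close> meaningful.
\<close>

definition sobolev_fun :: "real \<Rightarrow> (real^'d::finite \<Rightarrow> complex) set" where
  "sobolev_fun l = {f \<in> borel_measurable borel.
     (\<forall>\<phi>\<in>schwartz. integrable lborel (\<lambda>x. f x * \<phi> x)) \<and> distr_of f \<in> sobolev l}"

abbreviation H_norm :: "real \<Rightarrow> (real^'d::finite \<Rightarrow> complex) \<Rightarrow> real" where
  "H_norm l f \<equiv> sobolev_norm l (distr_of f)"

definition admissible_consts :: "'d::finite itself \<Rightarrow> real \<Rightarrow> real \<Rightarrow> real \<Rightarrow> real set" where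
  "admissible_consts _ l m n = {K. 0 \<le> K \<and>
     (\<forall>f\<in>sobolev_fun m. \<forall>g\<in>(sobolev_fun n :: (real^'d \<Rightarrow> complex) set).
        (\<lambda>x. f x * g x) \<in> sobolev_fun l \<and>
        H_norm l (\<lambda>x. f x * g x) \<le> K * H_norm m f * H_norm n g)}"

text \<open>
  The minimum is taken in the extended reals, so that it is meaningful (namely \<open>\<infinity>\<close>) without
  a proof that some constant is admissible; as soon as one is, \<open>sharp_const_is_min\<close> shows that
  it is the minimum in \<open>[0, \<infinity>)\<close>.
\<close>

definition sharp_const :: "'d::finite itself \<Rightarrow> real \<Rightarrow> real \<Rightarrow> real \<Rightarrow> ereal" where
  "sharp_const d l m n = Inf (ereal ` admissible_consts d l m n)"

lemma sobolev_norm_nonneg: "0 \<le> sobolev_norm l T"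
  by (simp add: sobolev_norm_def L2_norm_def)

lemma sharp_const_is_min:
  fixes d :: "'d::finite itself"
  assumes ne: "admissible_consts d l m n \<noteq> {}"
  shows "\<exists>K \<in> admissible_consts d l m n.
    sharp_const d l m n = ereal K \<and> (\<forall>K' \<in> admissible_consts d l m n. K \<le> K')"
proof -
  let ?A = "admissible_consts d l m n"
  define K where "K = Inf ?A"
  have bdd: "bdd_below ?A"
    by (rule bdd_belowI[of _ 0]) (simp add: admissible_consts_def)
  have le: "K \<le> K'" if "K' \<in> ?A" for K'
    unfolding K_def by (rule cInf_lower[OF that bdd])
  have K0: "0 \<le> K"
    unfolding K_def by (rule cInf_greatest[OF ne]) (simp add: admissible_consts_def)
  have bound: "c \<le> K * a * b" if "\<And>K'. K' \<in> ?A \<Longrightarrow> c \<le> K' * a * b" "0 \<le> a" "0 \<le> b" for a b c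
  proof (cases "a * b = 0")
    case True
    then show ?thesis using ne that(1) by (fastforce simp: mult.assoc)
  next
    case False
    then have pos: "0 < a * b" using that by (simp add: less_le)
    have "c / (a * b) \<le> K"
      unfolding K_def using that(1) pos
      by (intro cInf_greatest[OF ne]) (simp add: pos_divide_le_eq mult.assoc)
    then show ?thesis using pos by (simp add: pos_divide_le_eq mult.assoc)
  qed
  have mem: "K \<in> ?A"
    unfolding admissible_consts_def
  proof (intro CollectI conjI K0 ballI)
    fix f g :: "real^'d \<Rightarrow> complex"
    assume fg: "f \<in> sobolev_fun m" "g \<in> sobolev_fun n"
    show "(\<lambda>x. f x * g x) \<in> sobolev_fun l"
      using ne fg by (auto simp: admissible_consts_def)
    show "H_norm l (\<lambda>x. f x * g x) \<le> K * H_norm m f * H_norm n g"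
      using fg by (intro bound sobolev_norm_nonneg) (auto simp: admissible_consts_def)
  qed
  moreover have "sharp_const d l m n = ereal K"
    unfolding sharp_const_def
    by (rule antisym) (use mem le in \<open>auto intro!: INF_lower INF_greatest\<close>)
  ultimately show ?thesis using le by blast
qed

section \<open>Special functions\<close>

text \<open>
  Real argument \<open>w > 0\<close> only: because \<open>0 powr 0 = 0\<close>, the value at \<open>w = 0\<close> is wrong
  for \<open>\<nu> = 0\<close>.
\<close>

definition bessel_I :: "real \<Rightarrow> real \<Rightarrow> real" where
  "bessel_I \<nu> w = (w / 2) powr \<nu> * (\<Sum>k. (w / 2) ^ (2 * k) / fact k * rGamma (\<nu> + real k + 1))"

text \<open>Meant for odd \<open>s \<ge> -1\<close>.\<close>

definition dfact :: "int \<Rightarrow> int" where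
  "dfact s = \<Prod>{i \<in> {1..s}. odd i}"

section \<open>The trial functions\<close>

text \<open>The index \<open>e\<close> plays the role of the first coordinate.\<close>

definition gauss_wave :: "'d::finite \<Rightarrow> real \<Rightarrow> real \<Rightarrow> real^'d \<Rightarrow> complex" where
  "gauss_wave e p \<sigma> x = exp (\<i> * of_real (p * x $ e)) * of_real (exp (- (\<sigma> * (norm x)\<^sup>2 / 2)))"

definition KF :: "'d::finite \<Rightarrow> real \<Rightarrow> real \<Rightarrow> real \<Rightarrow> real \<Rightarrow> real \<Rightarrow> real \<Rightarrow> real \<Rightarrow> real" where
  "KF e l m n p q \<sigma> \<tau> = H_norm l (gauss_wave e (p + q) (\<sigma> + \<tau>)) /
     (H_norm m (gauss_wave e p \<sigma>) * H_norm n (gauss_wave e q \<tau>))"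

end

theory Submission
  imports Defs "HOL-Probability.Characteristic_Functions" "HOL-Probability.Sinc_Integral"
begin

text \<open>
  The Fourier transform of a trial function is a real Gaussian centred at \<open>p\<close> times the unit
  vector \<open>axis e 1\<close>, because the transform factors over the coordinates and the one-dimensional
  case is the characteristic function of the normal law. Hence the squared Sobolev norm is
  \<open>\<sigma>\<^sup>-\<^sup>d\<close> times the integral of \<open>(1 + |k|\<^sup>2)\<^sup>m\<close> against
  \<open>exp (- |k - p e|\<^sup>2 / \<sigma>)\<close> (\<open>H_norm_gauss_wave\<close>). Since a Sobolev norm is defined by a chosen
  \<open>L2\<close> representative of a distribution, this rests on such representatives being unique up to
  null sets (\<open>L2_eq_AE_if_distr_eq\<close>). Testing against all Gaussians is enough for that: box
  indicators smoothed by ever narrower Gaussians converge to the indicators almost everywhere, and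
  integrals over boxes determine an integrable function.

  The Bessel formula comes from expanding the factor \<open>exp (a k\<^sub>e)\<close>. Reflection in the origin
  replaces it by \<open>cosh (a k\<^sub>e)\<close>, whose series has non-negative terms. Each term is a radial function
  times \<open>k\<^sub>e\<close> to the power \<open>2j\<close>. The image of the measure with density \<open>k\<^sub>e\<close> to the
  power \<open>2j\<close> under the norm is homogeneous of degree \<open>2j + d\<close>, so it is a
  multiple of \<open>\<rho>\<close> to the power \<open>2j + d - 1\<close>, and a Gaussian test function fixes the multiple
  (\<open>nn_integral_polar_coord_power\<close>). Summing over \<open>j\<close> yields the Bessel series
  (\<open>integral_radial_exp\<close>). The case \<open>p = 0\<close> keeps only the first term of the series, and the
  limit \<open>p \<rightarrow> 0\<close> is dominated convergence in the integral over the whole space.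

  For an integer exponent, \<open>(1 + |k|\<^sup>2)\<^sup>m\<close> is expanded into products of powers of \<open>k\<^sub>e\<^sup>2\<close> and of
  the squared norm of the other coordinates. The former give the moments of a shifted normal law
  (\<open>gauss_moment_shifted\<close>), the latter a Pochhammer symbol, by induction on the number of
  coordinates and Vandermonde's identity (\<open>gauss_partial_radius_moment\<close>).

  The lower bound for the sharp constant holds because the product of two trial functions is again
  a trial function (\<open>gauss_wave_mult\<close>), so every admissible constant is at least the quotient of
  the three norms.
\<close>

section \<open>Products and one-dimensional Gaussian integrals\<close>

text \<open>
  Lebesgue measure on \<open>real^'d\<close> is the image of a product of copies of Lebesgue measure on the
  line, indexed by the unit vectors along the axes; re-indexing by coordinates gives Fubini for
  products. The values may be complex, as the Fourier transform requires.
\<close>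

lemma
  fixes f :: "'d::finite \<Rightarrow> real \<Rightarrow> 'b::{real_normed_field,banach,second_countable_topology}"
  assumes f: "\<And>i. integrable lborel (f i)"
  shows integrable_lborel_prod_vec:
      "integrable lborel (\<lambda>x::real^'d. \<Prod>i\<in>UNIV. f i (x $ i))" (is ?A)
    and integral_lborel_prod_vec:
      "(\<integral>x. (\<Prod>i\<in>UNIV. f i ((x::real^'d) $ i)) \<partial>lborel) = (\<Prod>i\<in>UNIV. integral\<^sup>L lborel (f i))" (is ?B)
proof -
  let ?ax = "\<lambda>i::'d. axis i (1::real)"
  let ?P = "\<Pi>\<^sub>M b\<in>(Basis::(real^'d) set). (lborel :: real measure)"
  let ?S = "\<lambda>g. \<Sum>b\<in>(Basis::(real^'d) set). g b *\<^sub>R b"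
  have inj: "inj ?ax" by (auto simp: inj_on_def axis_eq_axis)
  have Basis: "(Basis :: (real^'d) set) = range ?ax"
    by (auto simp: Basis_vec_def)
  define g where "g b = f (inv ?ax b)" for b
  have g: "g (?ax i) = f i" for i
    by (simp add: g_def inv_f_f[OF inj])
  have reidx: "(\<Prod>b\<in>Basis. h b) = (\<Prod>i\<in>UNIV. h (?ax i))" for h :: "_ \<Rightarrow> 'b"
    unfolding Basis using inj by (simp add: prod.reindex)
  have F: "(\<Prod>i\<in>UNIV. f i (x $ i)) = (\<Prod>b\<in>Basis. g b (x \<bullet> b))" for x :: "real^'d"
    by (simp add: reidx g inner_axis)
  interpret P: product_sigma_finite "\<lambda>b::real^'d. lborel :: real measure" ..
  have int: "integrable lborel (g b)" for b
    using f by (simp add: g_def)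
  have [measurable]: "g b \<in> borel_measurable borel" for b
    using borel_measurable_integrable[OF int[of b]] by simp
  have FS: "(\<Prod>b\<in>Basis. g b (?S y \<bullet> b)) = (\<Prod>b\<in>Basis. g b (y b))" for y
    by (intro prod.cong refl) (simp add: inner_sum_left_Basis)
  show ?A
    unfolding F lborel_eq[where 'a="real^'d"]
    by (subst integrable_distr_eq)
       (auto simp: FS intro!: P.product_integrable_prod int borel_measurable_prod)
  have "(\<integral>x. (\<Prod>i\<in>UNIV. f i ((x::real^'d) $ i)) \<partial>lborel) = (\<Prod>b\<in>Basis. integral\<^sup>L lborel (g b))"
    unfolding F lborel_eq[where 'a="real^'d"]
    by (subst integral_distr)
       (auto simp: FS intro!: P.product_integral_prod int borel_measurable_prod)
  then show ?B by (simp add: reidx g)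
qed

lemma pochhammer_half: "pochhammer (1/2 :: real) k = fact (2 * k) / (4 ^ k * fact k)"
  using fact_double[of k, where 'a=real] by (simp add: power_mult)

text \<open>
  The rescaled even moments of the normal law. Their usual quotient of factorials is a Pochhammer
  symbol at \<open>1/2\<close>, which is the form in which the moments of several coordinates add up by
  Vandermonde's identity.
\<close>

lemma gauss_moment_even:
  fixes s :: real assumes s: "0 < s"
  shows "has_bochner_integral lborel (\<lambda>x. (x - \<mu>) ^ (2 * k) * exp (- ((x - \<mu>)\<^sup>2 / s)))
           (sqrt (pi * s) * s ^ k * pochhammer (1/2) k)"
proof -
  have "has_bochner_integral lborel
     (\<lambda>x. sqrt (pi * s) * (normal_density \<mu> (sqrt (s / 2)) x * (x - \<mu>) ^ (2 * k)))
     (sqrt (pi * s) * (fact (2 * k) / ((2 / (sqrt (s / 2))\<^sup>2)^k * fact k)))"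
    by (intro has_bochner_integral_mult_right normal_moment_even) (use s in auto)
  moreover have "sqrt (pi * s) * (normal_density \<mu> (sqrt (s / 2)) x * (x - \<mu>) ^ (2 * k))
      = (x - \<mu>) ^ (2 * k) * exp (- ((x - \<mu>)\<^sup>2 / s))" for x
    using s by (simp add: normal_density_def)
  moreover have "fact (2 * k) / ((2 / (sqrt (s / 2))\<^sup>2)^k * fact k) = s ^ k * pochhammer (1/2) k"
    using s by (simp add: pochhammer_half power_divide field_simps)
  ultimately show ?thesis by (simp add: mult.assoc)
qed

lemma gauss_moment_odd:
  fixes s :: real assumes s: "0 < s"
  shows "has_bochner_integral lborel (\<lambda>x. (x - \<mu>) ^ (2 * k + 1) * exp (- ((x - \<mu>)\<^sup>2 / s))) 0"
proof -
  have "has_bochner_integral lborel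
     (\<lambda>x. sqrt (pi * s) * (normal_density \<mu> (sqrt (s / 2)) x * (x - \<mu>) ^ (2 * k + 1)))
     (sqrt (pi * s) * 0)"
    by (intro has_bochner_integral_mult_right normal_moment_odd) (use s in auto)
  moreover have "sqrt (pi * s) * (normal_density \<mu> (sqrt (s / 2)) x * (x - \<mu>) ^ (2 * k + 1))
      = (x - \<mu>) ^ (2 * k + 1) * exp (- ((x - \<mu>)\<^sup>2 / s))" for x
    using s by (simp add: normal_density_def)
  ultimately show ?thesis by (simp only: mult_zero_right)
qed

text \<open>
  The same Pochhammer symbol in terms of double factorials; for \<open>g = 0\<close> the index set in
  \<^const>\<open>dfact\<close> is empty, which gives \<open>(-1)!! = 1\<close>.
\<close>

lemma dfact_odd: "real_of_int (dfact (2 * int g - 1)) / 2 ^ g = pochhammer (1/2) g"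
proof (induction g)
  case 0
  then show ?case by (simp add: dfact_def)
next
  case (Suc g)
  define A where "A = {i \<in> {1..2 * int g - 1}. odd i}"
  have "{i \<in> {1..2 * int (Suc g) - 1}. odd i} = insert (2 * int g + 1) A"
    unfolding A_def by (rule set_eqI, simp, presburger)
  moreover have "finite A" "2 * int g + 1 \<notin> A"
    unfolding A_def by (rule finite_subset[of _ "{1..2 * int g - 1}"]) auto
  ultimately have "dfact (2 * int (Suc g) - 1) = (2 * int g + 1) * dfact (2 * int g - 1)"
    unfolding dfact_def A_def[symmetric] by simp
  then show ?case
    using Suc by (simp add: pochhammer_Suc field_simps)
qed

text \<open>
  Expand \<open>x = (x - p) + p\<close> binomially: the odd central moments vanish, so only the even indices
  \<open>r = 2g\<close> contribute.
\<close>

lemma gauss_moment_shifted: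
  fixes s :: real assumes s: "0 < s"
  shows "has_bochner_integral lborel (\<lambda>x. x ^ (2 * j) * exp (- ((x - p)\<^sup>2 / s)))
     (sqrt (pi * s) * (\<Sum>g\<le>j. real ((2 * j) choose (2 * g)) * p ^ (2 * j - 2 * g) * (s ^ g * pochhammer (1/2) g)))"
proof -
  define v :: "nat \<Rightarrow> real" where
    "v r = (if even r then sqrt (pi * s) * (s ^ (r div 2) * pochhammer (1/2) (r div 2)) else 0)" for r
  have v: "has_bochner_integral lborel (\<lambda>x. (x - p) ^ r * exp (- ((x - p)\<^sup>2 / s))) (v r)" for r
  proof (cases "even r")
    case True
    then obtain k where "r = 2 * k" by (auto elim: evenE)
    then show ?thesis using gauss_moment_even[OF s, of p k] by (simp add: v_def mult.assoc)
  next
    case False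
    then obtain k where "r = 2 * k + 1" by (auto elim: oddE)
    then show ?thesis using gauss_moment_odd[OF s, of p k] by (simp add: v_def)
  qed
  have "has_bochner_integral lborel
    (\<lambda>x. \<Sum>r\<le>2*j. (real ((2 * j) choose r) * p ^ (2 * j - r)) * ((x - p) ^ r * exp (- ((x - p)\<^sup>2 / s))))
    (\<Sum>r\<le>2*j. (real ((2 * j) choose r) * p ^ (2 * j - r)) * v r)"
    by (intro has_bochner_integral_sum has_bochner_integral_mult_right v)
  moreover have "(\<Sum>r\<le>2*j. (real ((2 * j) choose r) * p ^ (2 * j - r)) * ((x - p) ^ r * exp (- ((x - p)\<^sup>2 / s))))
     = x ^ (2 * j) * exp (- ((x - p)\<^sup>2 / s))" for x
    using binomial_ring[of "x - p" p "2 * j"] by (simp add: sum_distrib_left sum_distrib_right mult_ac)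
  moreover have "(\<Sum>r\<le>2*j. (real ((2 * j) choose r) * p ^ (2 * j - r)) * v r)
     = (\<Sum>r\<in>(\<lambda>g. 2 * g) ` {..j}. (real ((2 * j) choose r) * p ^ (2 * j - r)) * v r)"
    by (rule sum.mono_neutral_right) (auto simp: v_def elim!: evenE)
  moreover have "\<dots> = (\<Sum>g\<le>j. (real ((2 * j) choose (2*g)) * p ^ (2 * j - 2*g)) * v (2*g))"
    by (subst sum.reindex) (auto simp: inj_on_def)
  moreover have "\<dots> = sqrt (pi * s) * (\<Sum>g\<le>j. real ((2 * j) choose (2 * g)) * p ^ (2 * j - 2 * g) * (s ^ g * pochhammer (1/2) g))"
    by (simp add: v_def sum_distrib_left mult_ac)
  ultimately show ?thesis by simp
qed

text \<open>
  The substitution \<open>y = \<surd>\<sigma> x\<close> reduces this to the characteristic function of the standard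
  normal law at \<open>t / \<surd>\<sigma>\<close>.
\<close>

lemma gauss_fourier_1d:
  fixes \<sigma> t :: real assumes s: "0 < \<sigma>"
  shows "has_bochner_integral lborel (\<lambda>x. exp (\<i> * of_real (t * x)) * of_real (exp (- (\<sigma> * x\<^sup>2 / 2))))
           (of_real (sqrt (2 * pi / \<sigma>) * exp (- (t\<^sup>2 / (2 * \<sigma>)))) :: complex)"
proof -
  define r where "r = sqrt \<sigma>"
  have r: "0 < r" "r\<^sup>2 = \<sigma>" using s by (auto simp: r_def)
  let ?f = "\<lambda>y. std_normal_density y *\<^sub>R exp (\<i> * of_real (t / r * y)) :: complex"
  have std: "integrable lborel ?f"
    by (rule Bochner_Integration.integrable_bound[OF integrable_normal_density[of 1 0]]) auto
  have "char std_normal_distribution (t / r) = (\<integral>y. ?f y \<partial>lborel)"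
    unfolding char_def by (subst integral_density) (auto simp: normal_density_nonneg)
  then have "has_bochner_integral lborel ?f (of_real (exp (- ((t / r)\<^sup>2) / 2)))"
    using std unfolding char_std_normal_distribution by (simp add: has_bochner_integral_iff)
  from lborel_has_bochner_integral_real_affine_iff[THEN iffD1, OF _ this, of r 0]
  have "has_bochner_integral lborel (\<lambda>x. sqrt (2 * pi) *\<^sub>R ?f (0 + r * x))
          (sqrt (2 * pi) *\<^sub>R (of_real (exp (- ((t / r)\<^sup>2) / 2)) /\<^sub>R \<bar>r\<bar>))"
    using r by (intro has_bochner_integral_scaleR_right) auto
  moreover have "sqrt (2 * pi) *\<^sub>R ?f (0 + r * x) = exp (\<i> * of_real (t * x)) * of_real (exp (- (\<sigma> * x\<^sup>2 / 2)))" for x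
    using r by (simp add: std_normal_density_def scaleR_conv_of_real power_mult_distrib mult_ac exp_of_real)
  moreover have "sqrt (2 * pi) *\<^sub>R (of_real (exp (- ((t / r)\<^sup>2) / 2)) /\<^sub>R \<bar>r\<bar>)
      = (of_real (sqrt (2 * pi / \<sigma>) * exp (- (t\<^sup>2 / (2 * \<sigma>)))) :: complex)"
  proof -
    have "sqrt (2 * pi) * (exp (- ((t / r)\<^sup>2) / 2) / r) = sqrt (2 * pi / \<sigma>) * exp (- (t\<^sup>2 / (2 * \<sigma>)))"
      using r by (simp add: power_divide real_sqrt_divide flip: r_def)
    then show ?thesis
      using r by (simp only: scaleR_conv_of_real abs_of_pos of_real_mult[symmetric] divide_inverse mult_ac)
  qed
  ultimately show ?thesis by (simp only:)
qed

section \<open>Gaussians as test functions\<close>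

text \<open>
  Polynomials times one fixed Gaussian. Partial derivatives do not leave this class, which is how
  Gaussians are seen to be Schwartz functions without computing any higher derivative.
\<close>

inductive_set gauss_poly :: "real \<Rightarrow> real^'d::finite \<Rightarrow> (real^'d \<Rightarrow> complex) set"
  for a y where
  gauss: "(\<lambda>x. of_real (exp (- (a * (norm (x - y))\<^sup>2)))) \<in> gauss_poly a y"
| scale: "f \<in> gauss_poly a y \<Longrightarrow> (\<lambda>x. c * f x) \<in> gauss_poly a y"
| add: "f \<in> gauss_poly a y \<Longrightarrow> g \<in> gauss_poly a y \<Longrightarrow> (\<lambda>x. f x + g x) \<in> gauss_poly a y"
| coord: "f \<in> gauss_poly a y \<Longrightarrow> (\<lambda>x. of_real (x $ i) * f x) \<in> gauss_poly a y"

text \<open>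
  Differentiating the Gaussian itself produces a linear polynomial factor, and the product rule
  for a coordinate factor produces the function that it multiplies; both stay in the class.
\<close>

lemma gauss_poly_gradient:
  fixes y :: "real^'d::finite"
  assumes "f \<in> gauss_poly a y"
  shows "\<exists>D. (\<forall>i. D i \<in> gauss_poly a y) \<and>
     (\<forall>x. (f has_derivative (\<lambda>h. \<Sum>i\<in>UNIV. of_real (h $ i) * D i x)) (at x))"
  using assms
proof induction
  case gauss
  let ?E = "\<lambda>x::real^'d. of_real (exp (- (a * (norm (x - y))\<^sup>2))) :: complex"
  let ?D = "\<lambda>i x. of_real (x $ i) * (of_real (- 2 * a) * ?E x) + of_real (2 * a * y $ i) * ?E x"
  have "(?E has_derivative (\<lambda>h. \<Sum>i\<in>UNIV. of_real (h $ i) * ?D i x)) (at x)" for x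
  proof -
    have "((\<lambda>x. exp (- (a * ((x - y) \<bullet> (x - y))))) has_derivative
        (\<lambda>h. exp (- (a * ((x - y) \<bullet> (x - y)))) * (- (a * ((x - y) \<bullet> h + h \<bullet> (x - y)))))) (at x)"
      by (auto intro!: derivative_eq_intros simp: fun_eq_iff)
    then have "((\<lambda>x. of_real (exp (- (a * ((x - y) \<bullet> (x - y))))) :: complex) has_derivative
        (\<lambda>h. of_real (exp (- (a * ((x - y) \<bullet> (x - y)))) * (- (a * ((x - y) \<bullet> h + h \<bullet> (x - y))))))) (at x)"
      by (rule has_derivative_of_real)
    moreover have "(of_real (exp (- (a * ((x - y) \<bullet> (x - y)))) * (- (a * ((x - y) \<bullet> h + h \<bullet> (x - y))))) :: complex)
       = (\<Sum>i\<in>UNIV. of_real (h $ i) * ?D i x)" for h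
    proof -
      have "(x - y) \<bullet> h + h \<bullet> (x - y) = (\<Sum>i\<in>UNIV. 2 * (h $ i * (x $ i - y $ i)))"
        by (simp add: inner_vec_def mult.commute flip: sum_distrib_left)
      then show ?thesis
        by (simp add: power2_norm_eq_inner sum_distrib_left sum_distrib_right sum_negf[symmetric] algebra_simps del: sum_negf)
    qed
    ultimately show ?thesis by (simp only: power2_norm_eq_inner)
  qed
  moreover have "?D i \<in> gauss_poly a y" for i
    by (intro gauss_poly.intros)
  ultimately show ?case by (intro exI[of _ ?D]) blast
next
  case (scale f c)
  then obtain D where D: "\<And>i. D i \<in> gauss_poly a y"
    "\<And>x. (f has_derivative (\<lambda>h. \<Sum>i\<in>UNIV. of_real (h $ i) * D i x)) (at x)" by blast
  have "((\<lambda>x. c * f x) has_derivative (\<lambda>h. \<Sum>i\<in>UNIV. of_real (h $ i) * (c * D i x))) (at x)" for x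
    using has_derivative_mult_right[OF D(2), of c] by (simp add: sum_distrib_left mult_ac)
  with D(1) show ?case by (intro exI[of _ "\<lambda>i x. c * D i x"]) (auto intro: gauss_poly.intros)
next
  case (add f g)
  then obtain D D' where D: "\<And>i. D i \<in> gauss_poly a y"
    "\<And>x. (f has_derivative (\<lambda>h. \<Sum>i\<in>UNIV. of_real (h $ i) * D i x)) (at x)"
    and D': "\<And>i. D' i \<in> gauss_poly a y"
    "\<And>x. (g has_derivative (\<lambda>h. \<Sum>i\<in>UNIV. of_real (h $ i) * D' i x)) (at x)" by blast
  have "((\<lambda>x. f x + g x) has_derivative (\<lambda>h. \<Sum>i\<in>UNIV. of_real (h $ i) * (D i x + D' i x))) (at x)" for x
    using has_derivative_add[OF D(2) D'(2)] by (simp add: sum.distrib distrib_left)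
  with D(1) D'(1) show ?case
    by (intro exI[of _ "\<lambda>i x. D i x + D' i x"]) (auto intro: gauss_poly.intros)
next
  case (coord f j)
  then obtain D where D: "\<And>i. D i \<in> gauss_poly a y"
    "\<And>x. (f has_derivative (\<lambda>h. \<Sum>i\<in>UNIV. of_real (h $ i) * D i x)) (at x)" by blast
  let ?D = "\<lambda>i x. of_real (x $ j) * D i x + (if i = j then 1 else 0) * f x"
  have "((\<lambda>x. of_real (x $ j) * f x) has_derivative (\<lambda>h. \<Sum>i\<in>UNIV. of_real (h $ i) * ?D i x)) (at x)" for x
  proof -
    have "((\<lambda>x::real^'d. of_real (x $ j) :: complex) has_derivative (\<lambda>h. of_real (h $ j))) (at x)"
      by (intro bounded_linear_imp_has_derivative bounded_linear_compose[OF bounded_linear_of_real bounded_linear_vec_nth])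
    from has_derivative_mult[OF this D(2)]
    have "((\<lambda>x. of_real (x $ j) * f x) has_derivative
       (\<lambda>h. of_real (x $ j) * (\<Sum>i\<in>UNIV. of_real (h $ i) * D i x) + of_real (h $ j) * f x)) (at x)" .
    moreover have "of_real (x $ j) * (\<Sum>i\<in>UNIV. of_real (h $ i) * D i x) + of_real (h $ j) * f x
       = (\<Sum>i\<in>UNIV. of_real (h $ i) * ?D i x)" for h
    proof -
      have "(\<Sum>i\<in>UNIV. of_real (h $ i) * ?D i x) = (\<Sum>i\<in>UNIV. of_real (x $ j) * (of_real (h $ i) * D i x))
         + (\<Sum>i\<in>UNIV. if i = j then of_real (h $ j) * f x else 0)"
        unfolding sum.distrib[symmetric] by (intro sum.cong refl) (simp add: algebra_simps)
      then show ?thesis by (simp add: sum_distrib_left)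
    qed
    ultimately show ?thesis by simp
  qed
  with D(1) coord.hyps show ?case by (intro exI[of _ ?D]) (auto intro!: gauss_poly.intros)
qed

lemma partial_deriv_gauss_poly:
  assumes "f \<in> gauss_poly a y"
  shows "partial_deriv i f \<in> gauss_poly a y"
proof -
  obtain D where D: "\<And>i. D i \<in> gauss_poly a y"
    "\<And>x. (f has_derivative (\<lambda>h. \<Sum>i\<in>UNIV. of_real (h $ i) * D i x)) (at x)"
    using gauss_poly_gradient[OF assms] by blast
  have "partial_deriv i f x = D i x" for x
  proof -
    have "frechet_derivative f (at x) = (\<lambda>h. \<Sum>i\<in>UNIV. of_real (h $ i) * D i x)"
      using frechet_derivative_at[OF D(2)] by simp
    then have "partial_deriv i f x = (\<Sum>j\<in>UNIV. (if j = i then D i x else 0))"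
      unfolding partial_deriv_def by (simp add: axis_def if_distrib[of "\<lambda>c. c * _"] if_distrib[of of_real] cong: if_cong)
    then show ?thesis by simp
  qed
  then have "partial_deriv i f = D i" by blast
  with D(1) show ?thesis by simp
qed

text \<open>
  Multiplication by a coordinate costs one power of \<open>1 + |x|\<close>, so the induction has to run over
  all exponents \<open>N\<close> simultaneously.
\<close>

lemma gauss_poly_decay:
  fixes y :: "real^'d::finite"
  assumes "f \<in> gauss_poly a y" and a: "0 < a"
  shows "\<exists>C. \<forall>x. (1 + norm x) ^ N * norm (f x) \<le> C"
  using assms(1)
proof (induction arbitrary: N)
  case gauss
  have "(1 + norm x) ^ N * norm (of_real (exp (- (a * (norm (x - y))\<^sup>2))) :: complex)
     \<le> (1 + norm y) ^ N * exp ((real N)\<^sup>2 / (4 * a))" for x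
  proof -
    let ?r = "norm (x - y)"
    have "1 + norm x \<le> (1 + norm y) * (1 + ?r)"
      using norm_triangle_ineq2[of x y] mult_nonneg_nonneg[of "norm y" ?r]
      by (simp add: distrib_left distrib_right del: mult_nonneg_nonneg zero_le_mult_iff)
    also have "\<dots> \<le> (1 + norm y) * exp ?r"
      by (intro mult_left_mono exp_ge_add_one_self) auto
    finally have "(1 + norm x) ^ N \<le> ((1 + norm y) * exp ?r) ^ N"
      by (intro power_mono) auto
    then have "(1 + norm x) ^ N * exp (- (a * ?r\<^sup>2)) \<le> (1 + norm y) ^ N * (exp (N * ?r) * exp (- (a * ?r\<^sup>2)))"
      by (simp add: power_mult_distrib exp_of_nat_mult)
    also have "exp (N * ?r) * exp (- (a * ?r\<^sup>2)) = exp (N * ?r - a * ?r\<^sup>2)"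
      by (simp add: exp_diff exp_minus field_simps)
    \<comment> \<open>The right-hand side is the maximum of the quadratic, attained at \<open>N / (2 * a)\<close>.\<close>
    also have "N * ?r - a * ?r\<^sup>2 \<le> (real N)\<^sup>2 / (4 * a)"
    proof -
      have "0 \<le> (2 * a * ?r - N)\<^sup>2" by simp
      then show ?thesis using a by (simp add: field_simps power2_eq_square)
    qed
    finally show ?thesis by (simp add: mult_left_mono)
  qed
  then show ?case by blast
next
  case (scale f c)
  obtain C where C: "\<And>x. (1 + norm x) ^ N * norm (f x) \<le> C" using scale.IH[of N] by blast
  have "(1 + norm x) ^ N * norm (c * f x) \<le> norm c * C" for x
    using mult_left_mono[OF C[of x], of "norm c"] by (simp add: norm_mult mult_ac)
  then show ?case by blast
next
  case (add f g)
  obtain C C' where C: "\<And>x. (1 + norm x) ^ N * norm (f x) \<le> C" "\<And>x. (1 + norm x) ^ N * norm (g x) \<le> C'"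
    using add.IH[of N] by blast
  have "(1 + norm x) ^ N * norm (f x + g x) \<le> C + C'" for x
  proof -
    have "(1 + norm x) ^ N * norm (f x + g x) \<le> (1 + norm x) ^ N * (norm (f x) + norm (g x))"
      by (intro mult_left_mono norm_triangle_ineq) auto
    then show ?thesis using C(1)[of x] C(2)[of x] by (simp add: distrib_left)
  qed
  then show ?case by blast
next
  case (coord f i)
  obtain C where C: "\<And>x. (1 + norm x) ^ Suc N * norm (f x) \<le> C" using coord.IH[of "Suc N"] by blast
  have "(1 + norm x) ^ N * norm (of_real (x $ i) * f x) \<le> C" for x
  proof -
    have "(1 + norm x) ^ N * (\<bar>x $ i\<bar> * norm (f x)) \<le> (1 + norm x) ^ N * ((1 + norm x) * norm (f x))"
      using component_le_norm_cart[of x i] by (intro mult_left_mono mult_right_mono) auto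
    then show ?thesis using C[of x] by (simp add: norm_mult mult_ac)
  qed
  then show ?case by blast
qed

lemma gauss_poly_schwartz:
  assumes f: "f \<in> gauss_poly a y" and a: "0 < a"
  shows "f \<in> schwartz"
  unfolding schwartz_def
proof (intro CollectI allI conjI)
  fix "is" :: "'a list" and N
  have *: "partial_derivs is f \<in> gauss_poly a y"
    by (induction "is") (auto simp: f partial_deriv_gauss_poly)
  show "partial_derivs is f differentiable_on UNIV"
    using gauss_poly_gradient[OF *]
    by (auto simp: differentiable_on_def differentiable_def)
  obtain C where "\<And>x. (1 + norm x) ^ N * norm (partial_derivs is f x) \<le> C"
    using gauss_poly_decay[OF * a] by blast
  then show "bounded (range (\<lambda>x. (1 + norm x) ^ N *\<^sub>R partial_derivs is f x))"
    by (intro boundedI[of _ C]) auto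
qed

lemma schwartz_decay:
  assumes "\<phi> \<in> schwartz"
  obtains C where "\<And>x. (1 + norm x) ^ N * norm (\<phi> x) \<le> C"
proof -
  have "bounded (range (\<lambda>x. (1 + norm x) ^ N *\<^sub>R partial_derivs [] \<phi> x))"
    using assms unfolding schwartz_def by blast
  then obtain C where "\<And>x. norm ((1 + norm x) ^ N *\<^sub>R \<phi> x) \<le> C"
    by (auto simp: bounded_iff)
  then show ?thesis by (intro that[of C]) auto
qed

lemma schwartz_measurable:
  assumes "\<phi> \<in> schwartz" shows "\<phi> \<in> borel_measurable borel"
proof -
  have "partial_derivs [] \<phi> differentiable_on UNIV"
    using assms unfolding schwartz_def by blast
  then show ?thesis
    by (intro borel_measurable_continuous_onI differentiable_imp_continuous_on) simp
qed

lemma integrable_inverse_1_plus_square: "integrable lborel (\<lambda>x::real. 1 / (1 + x\<^sup>2))"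
proof -
  have "set_integrable lborel {0<..} (\<lambda>x::real. 1 / (1 + x\<^sup>2))"
    using integrable_I0i_1_div_plus_square
    by (simp add: interval_lebesgue_integrable_def zero_ereal_def)
  then have "integrable lborel (\<lambda>x::real. indicator {0..} x *\<^sub>R (1 / (1 + x\<^sup>2)))"
    unfolding set_integrable_def
  proof (rule integrable_cong_AE_imp)
    show "AE x::real in lborel. indicator {0<..} x *\<^sub>R (1 / (1 + x\<^sup>2)) = indicator {0..} x *\<^sub>R (1 / (1 + x\<^sup>2) :: real)"
      using AE_lborel_singleton[of "0::real"] by eventually_elim (simp add: indicator_def)
  qed simp
  then obtain c where "has_bochner_integral lborel (\<lambda>x::real. indicator {0..} x *\<^sub>R (1 / (1 + x\<^sup>2))) c"
    using has_bochner_integral_integrable by blast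
  from has_bochner_integral_even_function[OF this] show ?thesis
    by (auto simp: has_bochner_integral_iff)
qed

lemma integrable_prod_inverse:
  "integrable lborel (\<lambda>x::real^'d::finite. \<Prod>i\<in>UNIV. 1 / (1 + (x $ i)\<^sup>2))"
  by (rule integrable_lborel_prod_vec[where f="\<lambda>_ t. 1 / (1 + t\<^sup>2)"]) (rule integrable_inverse_1_plus_square)

text \<open>
  Each factor \<open>1 + (k $ i)\<^sup>2\<close> is at most \<open>(1 + |k|)\<^sup>2\<close>, so \<open>2 d\<close> extra powers of decay
  dominate the function by a product of integrable functions of one coordinate each.
\<close>

lemma schwartz_weighted_integrable:
  fixes \<phi> :: "real^'d::finite \<Rightarrow> complex"
  assumes \<phi>: "\<phi> \<in> schwartz"
  shows "integrable lborel (\<lambda>k. (1 + norm k) ^ M * norm (\<phi> k))"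
proof -
  obtain C where C: "\<And>x. (1 + norm x) ^ (M + 2 * CARD('d)) * norm (\<phi> x) \<le> C"
    using schwartz_decay[OF \<phi>] by blast
  note [measurable] = schwartz_measurable[OF \<phi>]
  have bound: "(1 + norm k) ^ M * norm (\<phi> k) \<le> C * (\<Prod>i\<in>UNIV. 1 / (1 + (k $ i)\<^sup>2))" for k
  proof -
    have "(\<Prod>i\<in>UNIV. 1 + (k $ i)\<^sup>2) \<le> (\<Prod>i\<in>(UNIV::'d set). (1 + norm k)\<^sup>2)"
    proof (intro prod_mono conjI)
      fix i
      have "\<bar>k $ i\<bar>\<^sup>2 \<le> (norm k)\<^sup>2" by (intro power_mono component_le_norm_cart) auto
      then have "(k $ i)\<^sup>2 \<le> (norm k)\<^sup>2" by simp
      then show "1 + (k $ i)\<^sup>2 \<le> (1 + norm k)\<^sup>2" by (simp add: power2_sum add_increasing2)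
    qed auto
    also have "\<dots> = (1 + norm k) ^ (2 * CARD('d))" by (simp add: power_mult)
    finally have "(\<Prod>i\<in>UNIV. 1 + (k $ i)\<^sup>2) * ((1 + norm k) ^ M * norm (\<phi> k))
       \<le> (1 + norm k) ^ (2 * CARD('d)) * ((1 + norm k) ^ M * norm (\<phi> k))"
      by (intro mult_right_mono) auto
    also have "\<dots> \<le> C" using C[of k] by (simp add: power_add mult_ac)
    finally show ?thesis
      using prod_pos[of UNIV "\<lambda>i. 1 + (k $ i)\<^sup>2"]
      by (simp add: prod_dividef pos_le_divide_eq add_pos_nonneg mult.commute)
  qed
  show ?thesis
    by (rule Bochner_Integration.integrable_bound[OF integrable_mult_right[OF integrable_prod_inverse, of C]])
       (use bound in \<open>auto intro: order_trans[OF _ abs_ge_self]\<close>)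
qed

lemma schwartz_integrable: "\<phi> \<in> schwartz \<Longrightarrow> integrable lborel (\<lambda>k. norm (\<phi> k))"
  using schwartz_weighted_integrable[of \<phi> 0] by simp

section \<open>Gaussian pairings determine an integrable function\<close>

text \<open>
  The integrability hypothesis of Fubini's theorem, in the form in which it arises for the
  Fourier pairing and for convolutions: domination by a product of integrable functions.
\<close>

lemma integrable_pair_bound:
  fixes f :: "'a::euclidean_space \<times> 'b::euclidean_space \<Rightarrow> 'c::{banach,second_countable_topology}"
  assumes f[measurable]: "f \<in> borel_measurable (lborel \<Otimes>\<^sub>M lborel)"
    and u: "integrable lborel u" "\<And>x. 0 \<le> u x" and v: "integrable lborel v" "\<And>y. 0 \<le> v y"
    and bound: "\<And>x y. norm (f (x, y)) \<le> u x * v y"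
  shows "integrable (lborel \<Otimes>\<^sub>M lborel) f"
proof (rule integrableI_bounded)
  have [measurable]: "u \<in> borel_measurable borel" "v \<in> borel_measurable borel"
    using borel_measurable_integrable[OF u(1)] borel_measurable_integrable[OF v(1)] by simp_all
  have "(\<integral>\<^sup>+z. ennreal (norm (f z)) \<partial>(lborel \<Otimes>\<^sub>M lborel)) = (\<integral>\<^sup>+x. \<integral>\<^sup>+y. ennreal (norm (f (x, y))) \<partial>lborel \<partial>lborel)"
    by (rule lborel.nn_integral_fst[symmetric]) simp
  also have "\<dots> \<le> (\<integral>\<^sup>+x. \<integral>\<^sup>+y. ennreal (u x) * ennreal (v y) \<partial>lborel \<partial>lborel)"
    using bound u(2) v(2) by (intro nn_integral_mono) (simp add: ennreal_mult[symmetric])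
  also have "\<dots> = ennreal (integral\<^sup>L lborel u) * ennreal (integral\<^sup>L lborel v)"
    using u v by (simp add: nn_integral_cmult nn_integral_multc nn_integral_eq_integral)
  also have "\<dots> < \<infinity>" by (simp add: ennreal_mult_less_top)
  finally show "(\<integral>\<^sup>+z. ennreal (norm (f z)) \<partial>(lborel \<Otimes>\<^sub>M lborel)) < \<infinity>" .
qed simp

lemma integral_lborel_affine:
  fixes f :: "'a::euclidean_space \<Rightarrow> 'b::{banach,second_countable_topology}"
  assumes [measurable]: "f \<in> borel_measurable borel" and c: "c \<noteq> 0"
  shows "(\<integral>y. f y \<partial>lborel) = \<bar>c\<bar> ^ DIM('a) *\<^sub>R (\<integral>z. f (t + c *\<^sub>R z) \<partial>lborel)"
  by (subst lborel_affine[OF c, of t]) (simp add: integral_density integral_distr)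

lemma integrable_gauss_vec:
  assumes a: "0 < a" shows "integrable lborel (\<lambda>x::real^'d::finite. exp (- (a * (norm x)\<^sup>2)))"
proof -
  have "integrable lborel (\<lambda>x::real^'d. \<Prod>i\<in>UNIV. exp (- (a * (x $ i)\<^sup>2)))"
  proof (rule integrable_lborel_prod_vec)
    show "integrable lborel (\<lambda>x. exp (- (a * x\<^sup>2)))"
      using gauss_moment_even[of "1 / a" 0 0] a by (simp add: has_bochner_integral_iff mult.commute)
  qed
  then show ?thesis
    by (simp add: norm_vec_def L2_set_def sum_nonneg sum_distrib_left flip: exp_sum sum_negf)
qed

lemma AE_not_frontier_box: "AE x in lborel. x \<notin> frontier (box l u)"
proof -
  have "frontier (box l u) \<in> null_sets lebesgue"
    using negligible_convex_frontier[OF convex_box(2)] by (simp add: negligible_iff_null_sets)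
  then have "frontier (box l u) \<in> null_sets lborel"
    by (subst (asm) null_sets_completion_iff) auto
  then show ?thesis by (rule AE_not_in)
qed

text \<open>
  By Fubini, pairing with a Gaussian-smoothed indicator is the integral over \<open>y \<in> B\<close> of the pairings with
  Gaussians centred at \<open>y\<close>.
\<close>

lemma gauss_convolution_zero:
  fixes H :: "real^'d::finite \<Rightarrow> complex"
  assumes H: "integrable lborel H"
    and zero: "\<And>y. (\<integral>x. exp (- (c * (norm (x - y))\<^sup>2)) *\<^sub>R H x \<partial>lborel) = 0"
    and c: "0 < c" and B: "B \<in> sets borel" "emeasure lborel B < \<infinity>"
  shows "(\<integral>x. (\<integral>y. indicator B y * exp (- (c * (norm (x - y))\<^sup>2)) \<partial>lborel) *\<^sub>R H x \<partial>lborel) = 0"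
proof -
  note [measurable] = B(1)
  have [measurable]: "H \<in> borel_measurable borel" using borel_measurable_integrable[OF H] by simp
  let ?f = "\<lambda>x y. (indicator B y * exp (- (c * (norm (x - y))\<^sup>2))) *\<^sub>R H x"
  have int: "integrable (lborel \<Otimes>\<^sub>M lborel) (\<lambda>(x, y). ?f x y)"
  proof (rule integrable_pair_bound[where u="\<lambda>x. norm (H x)" and v="indicator B"])
    show "integrable lborel (indicator B :: _ \<Rightarrow> real)" using B by simp
    show "norm (case (x, y) of (x, y) \<Rightarrow> ?f x y) \<le> norm (H x) * indicator B y" for x y
      using c by (auto simp: indicator_def mult_left_le_one_le)
  qed (use H in auto)
  have "(\<integral>x. (\<integral>y. indicator B y * exp (- (c * (norm (x - y))\<^sup>2)) \<partial>lborel) *\<^sub>R H x \<partial>lborel)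
    = (\<integral>x. (\<integral>y. ?f x y \<partial>lborel) \<partial>lborel)"
  proof (intro Bochner_Integration.integral_cong refl)
    fix x
    have "integrable lborel (\<lambda>y. indicator B y * exp (- (c * (norm (x - y))\<^sup>2)))"
      by (rule Bochner_Integration.integrable_bound[of _ "indicator B :: _ \<Rightarrow> real"])
         (use B c in \<open>auto simp: indicator_def\<close>)
    then show "(\<integral>y. indicator B y * exp (- (c * (norm (x - y))\<^sup>2)) \<partial>lborel) *\<^sub>R H x = (\<integral>y. ?f x y \<partial>lborel)"
      by (simp add: integral_scaleR_left)
  qed
  also have "\<dots> = (\<integral>y. (\<integral>x. ?f x y \<partial>lborel) \<partial>lborel)"
    by (rule lborel_pair.Fubini_integral[OF int, symmetric])
  also have "\<dots> = (\<integral>y. indicator B y *\<^sub>R (\<integral>x. exp (- (c * (norm (x - y))\<^sup>2)) *\<^sub>R H x \<partial>lborel) \<partial>lborel)"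
    by (simp flip: scaleR_scaleR)
  also have "\<dots> = 0" by (simp add: zero)
  finally show ?thesis .
qed

text \<open>
  The indicator of the box, smoothed by Gaussians of width \<open>1 / (n + 1)\<close>, converges to a multiple
  of the indicator away from the frontier of the box, which is a null set. A box is used because
  for a general open set the frontier may have positive measure.
\<close>

lemma gauss_pairing_zero_box:
  fixes H :: "real^'d::finite \<Rightarrow> complex"
  assumes H: "integrable lborel H"
    and zero: "\<And>a y. 0 < a \<Longrightarrow> (\<integral>x. exp (- (a * (norm (x - y))\<^sup>2)) *\<^sub>R H x \<partial>lborel) = 0"
  shows "(LINT x:box l u|lborel. H x) = 0"
proof -
  let ?B = "box l u"
  let ?E = "\<lambda>z::real^'d. exp (- (norm z)\<^sup>2)"
  have [measurable]: "H \<in> borel_measurable borel" using borel_measurable_integrable[OF H] by simp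
  have E: "integrable lborel ?E" using integrable_gauss_vec[of 1] by simp
  define Z where "Z = (\<integral>z. ?E z \<partial>lborel)"
  have Z0: "Z \<noteq> 0"
  proof
    assume "Z = 0"
    then have "AE z in lborel. ?E z = 0"
      unfolding Z_def using integral_nonneg_eq_0_iff_AE[OF E] by simp
    then show False by (simp add: AE_iff_null null_sets_def)
  qed
  have Z_nonneg: "0 \<le> Z" unfolding Z_def by simp
  define g where "g n x = (\<integral>z. indicator ?B (x + (1 / Suc n) *\<^sub>R z) * ?E z \<partial>lborel)" for n :: nat and x
  have int_g: "integrable lborel (\<lambda>z. indicator ?B (x + r *\<^sub>R z) * ?E z)" for x r
    by (rule Bochner_Integration.integrable_bound[OF E]) (auto simp: indicator_def)
  have [measurable]: "g n \<in> borel_measurable borel" for n unfolding g_def by measurable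
  have g_le: "norm (g n x) \<le> Z" for n x
  proof -
    have "0 \<le> g n x" unfolding g_def by (intro integral_nonneg_AE) auto
    moreover have "g n x \<le> Z"
      unfolding g_def Z_def by (intro integral_mono int_g E) (auto simp: indicator_def)
    ultimately show ?thesis by simp
  qed
  have g_zero: "(\<integral>x. g n x *\<^sub>R H x \<partial>lborel) = 0" for n
  proof -
    define r where "r = 1 / Suc n"
    have r: "0 < r" by (simp add: r_def)
    \<comment> \<open>The substitution \<open>y = x + r z\<close> moves the width from the Gaussian into the indicator.\<close>
    have "(\<integral>y. indicator ?B y * exp (- ((1 / r\<^sup>2) * (norm (x - y))\<^sup>2)) \<partial>lborel) = r ^ CARD('d) * g n x" for x
      using r by (subst integral_lborel_affine[where c=r and t=x])
         (simp_all add: g_def r_def power_mult_distrib power_divide)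
    then have "(\<integral>x. (r ^ CARD('d) * g n x) *\<^sub>R H x \<partial>lborel) = 0"
      using gauss_convolution_zero[OF H zero, of "1 / r\<^sup>2" ?B]
        emeasure_lborel_box_finite[of l u] r by simp
    then have "r ^ CARD('d) *\<^sub>R (\<integral>x. g n x *\<^sub>R H x \<partial>lborel) = 0"
      by (simp flip: scaleR_scaleR integral_scaleR_right)
    then show ?thesis using r by simp
  qed
  have lim_g: "AE x in lborel. (\<lambda>n. g n x) \<longlonglongrightarrow> indicator ?B x * Z"
    using AE_not_frontier_box[of l u]
  proof eventually_elim
    fix x assume x: "x \<notin> frontier ?B"
    have "(\<lambda>n. g n x) \<longlonglongrightarrow> (\<integral>z. indicator ?B x * ?E z \<partial>lborel)"
      unfolding g_def
    proof (rule integral_dominated_convergence[where w="?E"])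
      show "AE z in lborel. (\<lambda>n. indicator ?B (x + (1 / Suc n) *\<^sub>R z) * ?E z) \<longlonglongrightarrow> indicator ?B x * ?E z"
      proof (rule AE_I2)
        fix z
        have "(\<lambda>n. x + (1 / Suc n) *\<^sub>R z) \<longlonglongrightarrow> x + 0 *\<^sub>R z"
          by (intro tendsto_intros LIMSEQ_Suc lim_1_over_n)
        then have lim: "(\<lambda>n. x + (1 / Suc n) *\<^sub>R z) \<longlonglongrightarrow> x" by simp
        have "eventually (\<lambda>n. indicator ?B (x + (1 / Suc n) *\<^sub>R z) = (indicator ?B x :: real)) sequentially"
        proof (cases "x \<in> ?B")
          case True
          show ?thesis
            using topological_tendstoD[OF lim open_box True] by eventually_elim (simp add: True)
        next
          case False
          then have "x \<in> - closure ?B" using x interior_open[OF open_box, of l u] by (auto simp: frontier_def)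
          from topological_tendstoD[OF lim _ this]
          have "eventually (\<lambda>n. x + (1 / Suc n) *\<^sub>R z \<in> - closure ?B) sequentially" by auto
          then show ?thesis
            by eventually_elim (use False closure_subset[of ?B] in \<open>auto simp: indicator_def\<close>)
        qed
        then have "(\<lambda>n. indicator ?B (x + (1 / Suc n) *\<^sub>R z) :: real) \<longlonglongrightarrow> indicator ?B x"
          by (rule tendsto_eventually)
        then show "(\<lambda>n. indicator ?B (x + (1 / Suc n) *\<^sub>R z) * ?E z) \<longlonglongrightarrow> indicator ?B x * ?E z"
          by (intro tendsto_intros)
      qed
    qed (use E in \<open>auto simp: indicator_def\<close>)
    then show "(\<lambda>n. g n x) \<longlonglongrightarrow> indicator ?B x * Z" by (simp add: Z_def)
  qed
  have "(\<lambda>n. \<integral>x. g n x *\<^sub>R H x \<partial>lborel) \<longlonglongrightarrow> (\<integral>x. (indicator ?B x * Z) *\<^sub>R H x \<partial>lborel)"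
  proof (rule integral_dominated_convergence[where w="\<lambda>x. Z * norm (H x)"])
    show "AE x in lborel. (\<lambda>n. g n x *\<^sub>R H x) \<longlonglongrightarrow> (indicator ?B x * Z) *\<^sub>R H x"
      using lim_g by eventually_elim (intro tendsto_intros)
    show "AE x in lborel. norm (g n x *\<^sub>R H x) \<le> Z * norm (H x)" for n
      using g_le by (auto intro!: AE_I2 mult_right_mono)
  qed (use H in auto)
  then have "(\<integral>x. (indicator ?B x * Z) *\<^sub>R H x \<partial>lborel) = 0"
    unfolding g_zero by (simp add: LIMSEQ_const_iff)
  then have "Z *\<^sub>R (LINT x:?B|lborel. H x) = 0"
    unfolding set_lebesgue_integral_def integral_scaleR_right[symmetric] by (simp add: mult.commute)
  with Z0 show ?thesis by simp
qed

text \<open>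
  The Borel sets over which \<open>H\<close> has integral zero form a Dynkin system, and this system contains
  all boxes.
\<close>

lemma gauss_pairing_zero_imp_AE_zero:
  fixes H :: "real^'d::finite \<Rightarrow> complex"
  assumes H: "integrable lborel H"
    and zero: "\<And>a y. 0 < a \<Longrightarrow> (\<integral>x. exp (- (a * (norm (x - y))\<^sup>2)) *\<^sub>R H x \<partial>lborel) = 0"
  shows "AE x in lborel. H x = 0"
proof (rule sigma_finite_measure.density_zero[OF sigma_finite_lborel H])
  fix A :: "(real^'d) set" assume "A \<in> sets lborel"
  let ?G = "range (\<lambda>(a, b). box a b :: (real^'d) set)"
  have sets: "sets lborel = sigma_sets UNIV ?G" by (simp add: borel_eq_box)
  have set_int: "set_integrable lborel A H" if "A \<in> sets lborel" for A
    unfolding set_integrable_def using integrable_mult_indicator[OF that H] .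
  have box0: "(LINT x:box l u|lborel. H x) = 0" for l u
    using H zero by (rule gauss_pairing_zero_box)
  have UNIV0: "(LINT x:UNIV|lborel. H x) = 0"
  proof -
    let ?A = "\<lambda>n::nat. box (- (real n *\<^sub>R One)) (real n *\<^sub>R One) :: (real^'d) set"
    have "(\<lambda>n. LINT x:?A n|lborel. H x) \<longlonglongrightarrow> (LINT x:(\<Union>n. ?A n)|lborel. H x)"
    proof (rule set_integral_cont_up)
      show "incseq ?A"
        by (auto simp: incseq_def mem_box inner_add_left intro: order.strict_trans1 order.strict_trans2)
           (smt (verit) of_nat_mono)+
      show "set_integrable lborel (\<Union>n. ?A n) H" by (intro set_int) auto
    qed auto
    then show ?thesis
      unfolding UN_box_eq_UNIV box0 by (simp add: LIMSEQ_const_iff)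
  qed
  have "Int_stable ?G" by (auto simp: Int_stable_def box_Int_box)
  moreover have "?G \<subseteq> Pow UNIV" by simp
  moreover have "A \<in> sigma_sets UNIV ?G" using \<open>A \<in> sets lborel\<close> sets by simp
  ultimately show "(LINT x:A|lborel. H x) = 0"
  proof (induction rule: sigma_sets_induct_disjoint)
    case (basic A)
    then show ?case using box0 by auto
  next
    case empty
    then show ?case by (simp add: set_lebesgue_integral_def)
  next
    case (compl A)
    then have A: "A \<in> sets lborel" using sets by simp
    have "(LINT x:A \<union> (UNIV - A)|lborel. H x) = (LINT x:A|lborel. H x) + (LINT x:UNIV - A|lborel. H x)"
      using A by (intro set_integral_Un set_int) auto
    then show ?case using compl UNIV0 by simp
  next
    case (union A)
    then have A: "A i \<in> sets lborel" for i using sets by auto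
    have "(LINT x:(\<Union>i. A i)|lborel. H x) = (\<Sum>i. LINT x:A i|lborel. H x)"
      using union.hyps A by (intro lebesgue_integral_countable_add set_int) (auto simp: disjoint_family_on_def)
    then show ?case using union by simp
  qed
qed

section \<open>Sobolev norms of the trial functions as weighted Gaussian integrals\<close>

lemma norm_gauss_wave: "norm (gauss_wave e p \<sigma> x) = exp (- (\<sigma> / 2 * (norm x)\<^sup>2))"
  by (simp add: gauss_wave_def norm_mult)

lemma gauss_wave_measurable [measurable]: "gauss_wave e p \<sigma> \<in> borel_measurable borel"
proof -
  have "(\<lambda>x. x $ e) \<in> borel_measurable borel"
    by (intro borel_measurable_continuous_onI continuous_intros)
  then show ?thesis unfolding gauss_wave_def by measurable
qed

lemma gauss_wave_integrable:
  assumes "0 < \<sigma>" shows "integrable lborel (gauss_wave e p \<sigma>)"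
proof -
  have "integrable lborel (\<lambda>x. norm (gauss_wave e p \<sigma> x))"
    unfolding norm_gauss_wave using assms by (intro integrable_gauss_vec) simp
  then show ?thesis by (simp add: integrable_norm_iff)
qed

lemma gauss_wave_mult:
  "gauss_wave e p \<sigma> x * gauss_wave e q \<tau> x = gauss_wave e (p + q) (\<sigma> + \<tau>) x"
  by (simp add: gauss_wave_def exp_add[symmetric] of_real_mult[symmetric] algebra_simps add_divide_distrib
      exp_of_real[symmetric] del: of_real_mult)

lemma norm_vec_sq: "(norm x)\<^sup>2 = (\<Sum>i\<in>UNIV. (x $ i)\<^sup>2)" for x :: "real^'d::finite"
  by (simp add: norm_vec_def L2_set_def sum_nonneg)

lemma fourier_gauss_wave:
  fixes e :: "'d::finite"
  assumes s: "0 < \<sigma>"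
  shows "fourier (gauss_wave e p \<sigma>) k =
    of_real (\<sigma> powr (- real CARD('d) / 2) * exp (- ((norm (k - p *\<^sub>R axis e 1))\<^sup>2 / (2 * \<sigma>))))"
proof -
  define t where "t = p *\<^sub>R axis e 1 - k"
  have factor: "exp (- (\<i> * of_real (k \<bullet> x))) * gauss_wave e p \<sigma> x =
    (\<Prod>i\<in>UNIV. exp (\<i> * of_real (t $ i * x $ i)) * of_real (exp (- (\<sigma> * (x $ i)\<^sup>2 / 2))))" for x
  proof -
    have "(\<Sum>i\<in>UNIV. t $ i * x $ i) = t \<bullet> x" by (simp add: inner_vec_def)
    also have "\<dots> = p * x $ e - k \<bullet> x" by (simp add: t_def inner_diff_left inner_axis' )
    finally have *: "(\<Sum>i\<in>UNIV. t $ i * x $ i) = p * x $ e - k \<bullet> x" .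
    have "(\<Prod>i\<in>UNIV. exp (\<i> * of_real (t $ i * x $ i))) = exp (\<i> * of_real (p * x $ e - k \<bullet> x))"
      by (simp only: *[symmetric] of_real_sum sum_distrib_left exp_sum finite)
    moreover have "(\<Prod>i\<in>UNIV. exp (- (\<sigma> * (x $ i)\<^sup>2 / 2))) = exp (- (\<sigma> * (norm x)\<^sup>2 / 2))"
      by (simp add: norm_vec_sq sum_distrib_left sum_divide_distrib sum_negf flip: exp_sum)
    ultimately show ?thesis
      by (simp add: prod.distrib gauss_wave_def exp_add[symmetric] algebra_simps flip: of_real_prod)
  qed
  have "(\<integral>x. exp (- (\<i> * of_real (k \<bullet> x))) * gauss_wave e p \<sigma> x \<partial>lborel) =
    (\<Prod>i\<in>UNIV. of_real (sqrt (2 * pi / \<sigma>) * exp (- ((t $ i)\<^sup>2 / (2 * \<sigma>)))))"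
    unfolding factor using gauss_fourier_1d[OF s]
    by (subst integral_lborel_prod_vec) (auto simp: has_bochner_integral_iff)
  also have "\<dots> = of_real (sqrt (2 * pi / \<sigma>) ^ CARD('d) * exp (- ((norm t)\<^sup>2 / (2 * \<sigma>))))"
    by (simp add: prod.distrib norm_vec_sq sum_divide_distrib sum_negf exp_sum[symmetric] flip: of_real_prod)
  finally have "fourier (gauss_wave e p \<sigma>) k = of_real ((2 * pi) powr (- real CARD('d) / 2) *
      (sqrt (2 * pi / \<sigma>) ^ CARD('d) * exp (- ((norm t)\<^sup>2 / (2 * \<sigma>)))))"
    unfolding fourier_def by simp
  moreover have "(2 * pi) powr (- real CARD('d) / 2) * sqrt (2 * pi / \<sigma>) ^ CARD('d) = \<sigma> powr (- real CARD('d) / 2)"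
  proof -
    have "sqrt (2 * pi / \<sigma>) ^ CARD('d) = (2 * pi / \<sigma>) powr (real CARD('d) / 2)"
      using s by (simp add: powr_half_sqrt[symmetric] powr_powr flip: powr_realpow)
    also have "\<dots> = (2 * pi) powr (real CARD('d) / 2) * \<sigma> powr (- real CARD('d) / 2)"
      using s by (simp add: powr_divide powr_minus_divide)
    finally show ?thesis by (simp add: powr_minus_divide)
  qed
  moreover have "norm t = norm (k - p *\<^sub>R axis e 1)" unfolding t_def by (rule norm_minus_commute)
  ultimately show ?thesis by (simp only: mult.assoc[symmetric])
qed

lemma weight_le: "0 \<le> m \<Longrightarrow> (1 + (norm k)\<^sup>2) powr m \<le> (1 + norm k) ^ (2 * nat \<lceil>m\<rceil>)"
proof -
  assume m: "0 \<le> m"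
  have "(1 + (norm k)\<^sup>2) powr m \<le> (1 + (norm k)\<^sup>2) powr (nat \<lceil>m\<rceil>)"
    using m by (intro powr_mono) (auto simp: of_nat_nat)
  also have "\<dots> = (1 + (norm k)\<^sup>2) ^ nat \<lceil>m\<rceil>"
    by (rule powr_realpow) (simp add: add_pos_nonneg)
  also have "\<dots> \<le> ((1 + norm k)\<^sup>2) ^ nat \<lceil>m\<rceil>"
    by (intro power_mono) (simp_all add: power2_sum)
  finally show ?thesis by (simp add: power_mult)
qed

lemma powr_weight_schwartz_integrable:
  fixes \<phi> :: "real^'d::finite \<Rightarrow> complex"
  assumes \<phi>: "\<phi> \<in> schwartz" and m: "0 \<le> m"
  shows "integrable lborel (\<lambda>k. (1 + (norm k)\<^sup>2) powr m * norm (\<phi> k))"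
proof (rule Bochner_Integration.integrable_bound[OF schwartz_weighted_integrable[OF \<phi>, of "2 * nat \<lceil>m\<rceil>"]])
  note [measurable] = schwartz_measurable[OF \<phi>]
  show "(\<lambda>k. (1 + (norm k)\<^sup>2) powr m * norm (\<phi> k)) \<in> borel_measurable lborel"
    by measurable
qed (use weight_le[OF m] in \<open>auto intro!: AE_I2 mult_right_mono\<close>)

lemma gauss_schwartz:
  "0 < a \<Longrightarrow> (\<lambda>x. of_real (exp (- (a * (norm (x - y))\<^sup>2)))) \<in> schwartz"
  by (rule gauss_poly_schwartz[OF gauss_poly.gauss])

lemma weighted_gauss_integrable:
  fixes c :: "real^'d::finite"
  assumes "0 \<le> m" "0 < s"
  shows "integrable lborel (\<lambda>k. (1 + (norm k)\<^sup>2) powr m * exp (- ((norm (k - c))\<^sup>2 / s)))"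
  using powr_weight_schwartz_integrable[OF gauss_schwartz[of "1 / s" c] assms(1)] assms(2)
  by simp

lemma L2_schwartz_integrable:
  assumes h: "h \<in> L2" and \<phi>: "\<phi> \<in> schwartz"
  shows "integrable lborel (\<lambda>x. h x * \<phi> x)"
proof -
  note [measurable] = schwartz_measurable[OF \<phi>]
  have [measurable]: "h \<in> borel_measurable borel" and h2: "integrable lborel (\<lambda>x. (norm (h x))\<^sup>2)"
    using h by (auto simp: L2_def)
  obtain C where C: "\<And>x. norm (\<phi> x) \<le> C" using schwartz_decay[OF \<phi>, of 0] by auto
  have "integrable lborel (\<lambda>x. (norm (h x))\<^sup>2 + C * norm (\<phi> x))"
    using h2 schwartz_integrable[OF \<phi>] by simp
  then show ?thesis
  proof (rule Bochner_Integration.integrable_bound)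
    have "norm (h x * \<phi> x) \<le> norm ((norm (h x))\<^sup>2 + C * norm (\<phi> x))" for x
    proof -
      have "norm (h x) * norm (\<phi> x) \<le> (norm (h x))\<^sup>2 + norm (\<phi> x) * norm (\<phi> x)"
        using sum_squares_bound[of "norm (h x)" "norm (\<phi> x)"]
          mult_nonneg_nonneg[OF norm_ge_zero[of "h x"] norm_ge_zero[of "\<phi> x"]]
        unfolding power2_eq_square by linarith
      also have "norm (\<phi> x) * norm (\<phi> x) \<le> C * norm (\<phi> x)" using C by (intro mult_right_mono) auto
      finally show ?thesis by (simp add: norm_mult)
    qed
    then show "AE x in lborel. norm (h x * \<phi> x) \<le> norm ((norm (h x))\<^sup>2 + C * norm (\<phi> x))" by simp
  qed simp
qed

text \<open>
  The difference of two elements of \<^const>\<open>L2\<close> need not be integrable, so it is first multiplied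
  by a fixed Gaussian. A product of two Gaussians is a multiple of a third one, so testing this
  product against Gaussians only involves Schwartz functions.
\<close>

lemma L2_eq_AE_if_distr_eq:
  fixes h :: "real^'d::finite \<Rightarrow> complex"
  assumes h: "h \<in> L2" and h': "h' \<in> L2"
    and eq: "\<And>\<phi>. \<phi> \<in> schwartz \<Longrightarrow> distr_of h \<phi> = distr_of h' \<phi>"
  shows "AE x in lborel. h x = h' x"
proof -
  let ?E = "\<lambda>x::real^'d. exp (- (norm x)\<^sup>2)"
  let ?H = "\<lambda>x. ?E x *\<^sub>R (h x - h' x)"
  have S: "(\<lambda>x. of_real (?E x)) \<in> schwartz" using gauss_schwartz[of 1 "0 :: real^'d"] by simp
  have "AE x in lborel. ?H x = 0"
  proof (rule gauss_pairing_zero_imp_AE_zero)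
    show "integrable lborel ?H"
      using Bochner_Integration.integrable_diff[OF L2_schwartz_integrable[OF h S] L2_schwartz_integrable[OF h' S]]
      by (simp add: scaleR_conv_of_real algebra_simps)
    fix a :: real and y :: "real^'d" assume a: "0 < a"
    \<comment> \<open>Completing the square in \<open>a |x - y|\<^sup>2 + |x|\<^sup>2\<close> gives the new centre and the factor \<open>?K\<close>.\<close>
    let ?K = "exp (- (a / (a + 1) * (norm y)\<^sup>2))"
    let ?y = "(a / (a + 1)) *\<^sub>R y"
    let ?\<phi> = "\<lambda>x. of_real ?K * of_real (exp (- ((a + 1) * (norm (x - ?y))\<^sup>2))) :: complex"
    have \<phi>: "?\<phi> \<in> schwartz"
      using a by (intro gauss_poly_schwartz[of _ "a + 1" ?y] gauss_poly.intros) auto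
    have "exp (- (a * (norm (x - y))\<^sup>2)) *\<^sub>R ?H x = h x * ?\<phi> x - h' x * ?\<phi> x" for x
    proof -
      have "a * (norm (x - y))\<^sup>2 + (norm x)\<^sup>2 = a / (a + 1) * (norm y)\<^sup>2 + (a + 1) * (norm (x - ?y))\<^sup>2"
      proof -
        define t where "t = a / (a + 1)"
        have t: "(a + 1) * t = a" using a by (simp add: t_def)
        have t': "t + a * t = a" using t by (simp add: algebra_simps)
        have "t * Y + (a + 1) * (X - t * W - t * (W - t * Y)) = a * (X - W - (W - Y)) + X" for X W Y
        proof -
          have "t * Y + (a + 1) * (X - t * W - t * (W - t * Y))
            = (a + 1) * X - 2 * (((a + 1) * t) * W) + (t + ((a + 1) * t) * t) * Y"
            by (simp add: algebra_simps)
          also have "\<dots> = a * (X - W - (W - Y)) + X"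
            unfolding t t' by (simp add: algebra_simps)
          finally show ?thesis .
        qed
        from this[symmetric]
        have "a * (x \<bullet> x - x \<bullet> y - (x \<bullet> y - y \<bullet> y)) + x \<bullet> x
            = t * (y \<bullet> y) + (a + 1) * (x \<bullet> x - t * (x \<bullet> y) - t * (x \<bullet> y - t * (y \<bullet> y)))" .
        then show ?thesis
          unfolding power2_norm_eq_inner t_def[symmetric]
          by (simp only: inner_diff_left inner_diff_right inner_scaleR_left inner_scaleR_right inner_commute[of y x])
      qed
      then have "exp (- (a * (norm (x - y))\<^sup>2)) * ?E x = ?K * exp (- ((a + 1) * (norm (x - ?y))\<^sup>2))"
        by (simp flip: exp_add) 
      then show ?thesis
        by (simp add: scaleR_conv_of_real algebra_simps flip: of_real_mult)
    qed
    then have "(\<integral>x. exp (- (a * (norm (x - y))\<^sup>2)) *\<^sub>R ?H x \<partial>lborel) = distr_of h ?\<phi> - distr_of h' ?\<phi>"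
      unfolding distr_of_def
      using Bochner_Integration.integral_diff[OF L2_schwartz_integrable[OF h \<phi>] L2_schwartz_integrable[OF h' \<phi>]]
      by simp
    then show "(\<integral>x. exp (- (a * (norm (x - y))\<^sup>2)) *\<^sub>R ?H x \<partial>lborel) = 0"
      using eq[OF \<phi>] by simp
  qed
  then show ?thesis by eventually_elim simp
qed

text \<open>
  The choice made in \<^const>\<open>sobolev_norm\<close> does not matter: any representative computes the
  norm.
\<close>

lemma sobolev_norm_eq_L2_norm:
  assumes h: "weighted_fourier l T h"
  shows "sobolev_norm l T = L2_norm h"
proof -
  define h' where "h' = (SOME h. weighted_fourier l T h)"
  have h': "weighted_fourier l T h'" unfolding h'_def using h by (rule someI[of "weighted_fourier l T"])
  have "AE x in lborel. h' x = h x"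
    using h h' by (intro L2_eq_AE_if_distr_eq) (auto simp: weighted_fourier_def)
  then have ae: "AE x in lborel. (norm (h' x))\<^sup>2 = (norm (h x))\<^sup>2" by eventually_elim simp
  have "h \<in> borel_measurable borel" "h' \<in> borel_measurable borel"
    using h h' by (auto simp: weighted_fourier_def L2_def)
  then have "(\<integral>x. (norm (h' x))\<^sup>2 \<partial>lborel) = (\<integral>x. (norm (h x))\<^sup>2 \<partial>lborel)"
    by (intro integral_cong_AE ae) auto
  then show ?thesis by (simp add: sobolev_norm_def L2_norm_def h'_def)
qed

lemma fourier_pairing_symmetric:
  fixes f g :: "real^'d::finite \<Rightarrow> complex"
  assumes f: "integrable lborel f" and g: "integrable lborel g"
  shows "(\<integral>x. f x * fourier g x \<partial>lborel) = (\<integral>k. fourier f k * g k \<partial>lborel)"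
proof -
  have [measurable]: "f \<in> borel_measurable borel" "g \<in> borel_measurable borel"
    using borel_measurable_integrable[OF f] borel_measurable_integrable[OF g] by simp_all
  let ?c = "of_real ((2 * pi) powr (- real CARD('d) / 2)) :: complex"
  let ?e = "\<lambda>x k::real^'d. exp (- (\<i> * of_real (x \<bullet> k)))"
  let ?F = "\<lambda>x k. ?c * (f x * (?e x k * g k))"
  have int: "integrable (lborel \<Otimes>\<^sub>M lborel) (\<lambda>(x, k). f x * (?e x k * g k))"
    by (rule integrable_pair_bound[where u="\<lambda>x. norm (f x)" and v="\<lambda>x. norm (g x)"])
       (use f g in \<open>auto simp: norm_mult\<close>)
  then have int: "integrable (lborel \<Otimes>\<^sub>M lborel) (\<lambda>(x, k). ?F x k)"
    unfolding split_def by (rule integrable_mult_right)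
  have "(\<integral>x. f x * fourier g x \<partial>lborel) = (\<integral>x. \<integral>k. ?F x k \<partial>lborel \<partial>lborel)"
    unfolding fourier_def
  proof (intro Bochner_Integration.integral_cong refl)
    fix x
    have "(\<integral>k. ?F x k \<partial>lborel) = ?c * (f x * (\<integral>k. ?e x k * g k \<partial>lborel))"
      by (simp only: integral_mult_right_zero)
    from trans[OF mult.left_commute this[symmetric]]
    show "f x * (?c * (\<integral>k. ?e x k * g k \<partial>lborel)) = (\<integral>k. ?F x k \<partial>lborel)" .
  qed
  also have "\<dots> = (\<integral>k. \<integral>x. ?F x k \<partial>lborel \<partial>lborel)"
    by (rule lborel_pair.Fubini_integral[OF int, symmetric])
  also have "\<dots> = (\<integral>k. fourier f k * g k \<partial>lborel)"
    unfolding fourier_def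
  proof (intro Bochner_Integration.integral_cong refl)
    fix k
    have "(\<integral>x. ?F x k \<partial>lborel) = (\<integral>x. (?c * g k) * (?e k x * f x) \<partial>lborel)"
      by (simp add: mult_ac inner_commute)
    also have "\<dots> = (?c * g k) * (\<integral>x. ?e k x * f x \<partial>lborel)"
      by (rule integral_mult_right_zero)
    finally show "(\<integral>x. ?F x k \<partial>lborel) = ?c * (\<integral>x. ?e k x * f x \<partial>lborel) * g k"
      by (simp only: mult_ac)
  qed
  finally show ?thesis .
qed

lemma integrable_mult_schwartz:
  assumes f: "integrable lborel f" and \<phi>: "\<phi> \<in> schwartz"
  shows "integrable lborel (\<lambda>x. f x * \<phi> x :: complex)"
proof -
  obtain C where C: "\<And>x. norm (\<phi> x) \<le> C" using schwartz_decay[OF \<phi>, of 0] by auto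
  note [measurable] = schwartz_measurable[OF \<phi>] borel_measurable_integrable[OF f]
  have C0: "0 \<le> C" using C norm_ge_zero order_trans by blast
  show ?thesis
    by (rule Bochner_Integration.integrable_bound[OF integrable_mult_right[OF integrable_norm[OF f], of C]])
       (use C C0 in \<open>auto intro!: AE_I2 simp: norm_mult mult.commute intro: mult_right_mono\<close>)
qed

text \<open>
  A single seminorm, the supremum norm, dominates the pairing with an integrable function.
\<close>

lemma distr_of_tempered:
  fixes f :: "real^'d::finite \<Rightarrow> complex"
  assumes f: "integrable lborel f"
  shows "distr_of f \<in> tempered"
  unfolding tempered_def
proof (intro CollectI conjI ballI allI)
  fix \<phi> \<psi> :: "real^'d \<Rightarrow> complex" assume "\<phi> \<in> schwartz" "\<psi> \<in> schwartz"
  then show "distr_of f (\<lambda>x. \<phi> x + \<psi> x) = distr_of f \<phi> + distr_of f \<psi>"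
    using integrable_mult_schwartz[OF f] by (simp add: distr_of_def distrib_left)
next
  fix c and \<phi> :: "real^'d \<Rightarrow> complex" assume "\<phi> \<in> schwartz"
  show "distr_of f (\<lambda>x. c * \<phi> x) = c * distr_of f \<phi>"
    by (simp add: distr_of_def mult.left_commute)
next
  have "norm (distr_of f \<phi>) \<le> (\<integral>x. norm (f x) \<partial>lborel) * (\<Sum>is\<in>{is. length is \<le> 0}. schwartz_seminorm 0 is \<phi>)"
    if \<phi>: "\<phi> \<in> schwartz" for \<phi>
  proof -
    obtain C where C: "\<And>x. norm (\<phi> x) \<le> C" using schwartz_decay[OF \<phi>, of 0] by auto
    then have le: "norm (\<phi> x) \<le> schwartz_seminorm 0 [] \<phi>" for x
      unfolding schwartz_seminorm_def by (auto intro!: cSUP_upper bdd_aboveI)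
    have "norm (distr_of f \<phi>) \<le> (\<integral>x. norm (f x * \<phi> x) \<partial>lborel)"
      unfolding distr_of_def by (rule integral_norm_bound)
    also have "\<dots> \<le> (\<integral>x. norm (f x) * schwartz_seminorm 0 [] \<phi> \<partial>lborel)"
    proof (rule integral_mono)
      show "integrable lborel (\<lambda>x. norm (f x * \<phi> x))"
        by (intro integrable_norm integrable_mult_schwartz f \<phi>)
      show "norm (f x * \<phi> x) \<le> norm (f x) * schwartz_seminorm 0 [] \<phi>" for x
        unfolding norm_mult by (intro mult_left_mono le) simp
    qed (use f in simp)
    also have "\<dots> = (\<integral>x. norm (f x) \<partial>lborel) * schwartz_seminorm 0 [] \<phi>" by simp
    finally show ?thesis by simp
  qed
  then show "\<exists>C N. \<forall>\<phi>\<in>schwartz. norm (distr_of f \<phi>) \<le> C * (\<Sum>is\<in>{is. length is \<le> N}. schwartz_seminorm N is \<phi>)"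
    by blast
qed

text \<open>
  For an integrable function the distributional Fourier transform is the classical one, because
  the Fourier transform is symmetric with respect to the bilinear pairing.
\<close>

lemma weighted_fourier_distr_of:
  fixes f :: "real^'d::finite \<Rightarrow> complex"
  assumes f: "integrable lborel f" and m: "0 \<le> m"
    and L2: "(\<lambda>k. weight m k * fourier f k) \<in> L2"
  shows "weighted_fourier m (distr_of f) (\<lambda>k. weight m k * fourier f k)"
  unfolding weighted_fourier_def
proof (intro conjI ballI L2)
  fix \<phi> :: "real^'d \<Rightarrow> complex" assume \<phi>: "\<phi> \<in> schwartz"
  note [measurable] = schwartz_measurable[OF \<phi>]
  have "integrable lborel (\<lambda>k. norm (weight m k * \<phi> k))"
    using powr_weight_schwartz_integrable[OF \<phi>, of "m / 2"] m by (simp add: weight_def norm_mult)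
  then have "integrable lborel (\<lambda>k. weight m k * \<phi> k)"
    by (subst (asm) integrable_norm_iff) (simp_all add: weight_def)
  from fourier_pairing_symmetric[OF f this]
  show "distr_mult (weight m) (distr_fourier (distr_of f)) \<phi> = distr_of (\<lambda>k. weight m k * fourier f k) \<phi>"
    by (simp add: distr_mult_def distr_fourier_def distr_of_def mult_ac)
qed

text \<open>
  All norms of trial functions are read off from this integral. It converges because
  a Gaussian is a Schwartz function.
\<close>

lemma
  fixes e :: "'d::finite"
  assumes m: "0 \<le> m" and s: "0 < \<sigma>"
  shows gauss_wave_sobolev_fun: "gauss_wave e p \<sigma> \<in> sobolev_fun m" (is ?A)
    and H_norm_gauss_wave: "(H_norm m (gauss_wave e p \<sigma>))\<^sup>2 =
      (\<integral>k. (1 + (norm k)\<^sup>2) powr m * exp (- ((norm ((k::real^'d) - p *\<^sub>R axis e 1))\<^sup>2 / \<sigma>)) \<partial>lborel) / \<sigma> ^ CARD('d)" (is ?B)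
proof -
  let ?f = "gauss_wave e p \<sigma>" and ?c = "p *\<^sub>R axis e 1 :: real^'d"
  let ?h = "\<lambda>k. weight m k * fourier ?f k"
  have sq: "(norm (?h k))\<^sup>2 = (1 + (norm k)\<^sup>2) powr m * exp (- ((norm (k - ?c))\<^sup>2 / \<sigma>)) / \<sigma> ^ CARD('d)" for k
  proof -
    have "((1 + (norm k)\<^sup>2) powr (m / 2))\<^sup>2 = (1 + (norm k)\<^sup>2) powr m"
      by (simp add: power2_eq_square flip: powr_add)
    moreover have "(\<sigma> powr (- real CARD('d) / 2))\<^sup>2 = 1 / \<sigma> ^ CARD('d)"
      using s by (simp add: power2_eq_square powr_minus_divide powr_realpow flip: powr_add)
    moreover have "(exp (- ((norm (k - ?c))\<^sup>2 / (2 * \<sigma>))))\<^sup>2 = exp (- ((norm (k - ?c))\<^sup>2 / \<sigma>))"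
      using s by (simp add: power2_eq_square field_simps flip: exp_add)
    ultimately show ?thesis
      by (simp add: fourier_gauss_wave[OF s] weight_def norm_mult power_mult_distrib)
  qed
  have meas: "?h \<in> borel_measurable borel"
    unfolding fourier_gauss_wave[OF s] weight_def by measurable
  have "integrable lborel (\<lambda>k. (norm (?h k))\<^sup>2)"
    unfolding sq using weighted_gauss_integrable[OF m s, of ?c] by simp
  with meas have "?h \<in> L2" by (simp add: L2_def)
  then have wf: "weighted_fourier m (distr_of ?f) ?h"
    by (rule weighted_fourier_distr_of[OF gauss_wave_integrable[OF s] m])
  then show ?A
    unfolding sobolev_fun_def sobolev_def
    using distr_of_tempered[OF gauss_wave_integrable[OF s]] integrable_mult_schwartz[OF gauss_wave_integrable[OF s]]
    by auto
  have "(L2_norm ?h)\<^sup>2 = (\<integral>k. (norm (?h k))\<^sup>2 \<partial>lborel)"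
    unfolding L2_norm_def by simp
  then show ?B
    unfolding sobolev_norm_eq_L2_norm[OF wf] sq by simp
qed

section \<open>Polar coordinates and the Bessel series\<close>

text \<open>
  The Gamma function covers both parities of \<open>n\<close>; both occur, according to the parity of the
  dimension.
\<close>

lemma gauss_half_moment:
  "has_bochner_integral lborel (\<lambda>x::real. indicator {0..} x *\<^sub>R (exp (- x\<^sup>2) * x ^ n)) (Gamma ((real n + 1) / 2) / 2)"
proof (cases "even n")
  case True
  then obtain k where n: "n = 2 * k" by (auto elim: evenE)
  have "Gamma (1 / 2 + real k) = pochhammer (1 / 2) k * sqrt pi"
    by (subst pochhammer_Gamma) (auto simp: Gamma_one_half_real field_simps)
  then have "Gamma ((real n + 1) / 2) / 2 = (sqrt pi / 2) * (fact (2 * k) / (2 ^ (2 * k) * fact k))"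
    using power_mult[of "2::real" 2 k]
    by (simp add: n add_divide_distrib add.commute pochhammer_half mult_ac)
  then show ?thesis using gaussian_moment_even_pos[of k] by (simp add: n mult_ac)
next
  case False
  then obtain k where n: "n = 2 * k + 1" by (auto elim: oddE)
  have "(real n + 1) / 2 = 1 + real k" by (simp add: n)
  then have "Gamma ((real n + 1) / 2) = fact k" by (simp only: Gamma_fact)
  then show ?thesis using gaussian_moment_odd_pos[of k] by (simp only: n)
qed

lemma nn_integral_lborel_affine:
  fixes f :: "'a::euclidean_space \<Rightarrow> ennreal"
  assumes [measurable]: "f \<in> borel_measurable borel" and c: "c \<noteq> 0"
  shows "(\<integral>\<^sup>+y. f y \<partial>lborel) = ennreal (\<bar>c\<bar> ^ DIM('a)) * (\<integral>\<^sup>+z. f (t + c *\<^sub>R z) \<partial>lborel)"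
  by (subst lborel_affine[OF c, of t]) (simp add: nn_integral_density nn_integral_distr nn_integral_cmult)

lemma measurable_vec_nth [measurable]: "(\<lambda>x::real^'d::finite. x $ i) \<in> borel_measurable borel"
  by (intro borel_measurable_continuous_onI continuous_intros)

text \<open>
  The part of polar integration needed here. Substituting \<open>k = R z\<close> shows that the ball of radius
  \<open>R\<close> has weighted measure proportional to \<open>R ^ N\<close>, and a measure on the line is determined by
  its values on the half-lines \<open>{..R}\<close>, as long as these are finite.
\<close>

lemma polar_moment_measure:
  fixes e :: "'d::finite" and j :: nat
  defines "N \<equiv> 2 * j + CARD('d)"
  shows "\<exists>c. distr (density lborel (\<lambda>k::real^'d. ennreal ((k $ e) ^ (2 * j)))) borel norm
     = density lborel (\<lambda>\<rho>. c * ennreal (indicator {0..} \<rho> * \<rho> ^ (N - 1)))" (is "\<exists>c. ?M = ?D c")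
proof -
  let ?w = "\<lambda>k::real^'d. ennreal ((k $ e) ^ (2 * j))"
  define A where "A = (\<integral>\<^sup>+k. ?w k * indicator {k. norm k \<le> 1} k \<partial>lborel)"
  define c where "c = ennreal (real N) * A"
  have N: "0 < N" by (simp add: N_def)
  have A: "A < \<infinity>"
  proof -
    have "A \<le> (\<integral>\<^sup>+k. indicator (cball (0::real^'d) 1) k \<partial>lborel)"
      unfolding A_def
    proof (intro nn_integral_mono)
      fix k :: "real^'d"
      have "(k $ e) ^ (2 * j) \<le> 1" if "norm k \<le> 1"
      proof -
        have "\<bar>k $ e\<bar> ^ (2 * j) \<le> 1"
          using component_le_norm_cart[of k e] that by (intro power_le_one) auto
        then show ?thesis by (simp add: power_even_abs)
      qed
      then show "?w k * indicator {k. norm k \<le> 1} k \<le> indicator (cball 0 1) k"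
        by (auto simp: indicator_def)
    qed
    also have "\<dots> = emeasure lborel (cball (0::real^'d) 1)" by simp
    also have "\<dots> < \<infinity>" by (rule emeasure_bounded_finite) simp
    finally show ?thesis .
  qed
  have M: "emeasure ?M {..R} = (if 0 \<le> R then ennreal (R ^ N) * A else 0)" for R
  proof -
    have "norm -` {..R} = cball (0 :: real^'d) R" by auto
    then have [measurable]: "norm -` {..R} \<in> sets (borel :: (real^'d) measure)" by simp
    have *: "emeasure ?M {..R} = (\<integral>\<^sup>+k. ?w k * indicator {k. norm k \<le> R} k \<partial>lborel)"
      by (subst emeasure_distr, measurable, subst emeasure_density)
         (auto intro!: nn_integral_cong simp: indicator_def)
    consider "R < 0" | "R = 0" | "0 < R" by linarith
    then show ?thesis
    proof cases
      case 1
      then have "indicator {k::real^'d. norm k \<le> R} k = (0 :: ennreal)" for k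
        using norm_ge_zero[of k] by (auto simp: indicator_def simp del: norm_ge_zero)
      then show ?thesis using 1 by (simp add: *)
    next
      case 2
      have "(\<integral>\<^sup>+k. ?w k * indicator {k. norm k \<le> R} k \<partial>lborel) = (\<integral>\<^sup>+k. 0 \<partial>(lborel :: (real^'d) measure))"
        using AE_lborel_singleton[of "0 :: real^'d"]
        by (intro nn_integral_cong_AE, eventually_elim) (auto simp: 2 indicator_def)
      then have "emeasure ?M {..R} = 0" unfolding * by simp
      then show ?thesis using N 2 by (simp add: power_0_left)
    next
      case 3
      have "(\<integral>\<^sup>+k. ?w k * indicator {k. norm k \<le> R} k \<partial>lborel)
        = ennreal (R ^ CARD('d)) * (\<integral>\<^sup>+z. ?w (R *\<^sub>R z) * indicator {k. norm k \<le> R} (R *\<^sub>R z) \<partial>lborel)"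
        using 3 by (subst nn_integral_lborel_affine[where c=R and t=0]) auto
      also have "(\<integral>\<^sup>+z. ?w (R *\<^sub>R z) * indicator {k. norm k \<le> R} (R *\<^sub>R z) \<partial>lborel)
        = (\<integral>\<^sup>+z. ennreal (R ^ (2 * j)) * (?w z * indicator {k. norm k \<le> 1} z) \<partial>lborel)"
        using 3 by (intro nn_integral_cong)
          (auto simp: indicator_def power_mult_distrib ennreal_mult)
      also have "\<dots> = ennreal (R ^ (2 * j)) * A"
        unfolding A_def by (rule nn_integral_cmult) measurable
      finally show ?thesis
        unfolding * using 3 by (simp add: N_def power_add ennreal_mult mult_ac)
    qed
  qed
  have D: "emeasure (?D c) {..R} = (if 0 \<le> R then ennreal (R ^ N) * A else 0)" for R
  proof -
    have "emeasure (?D c) {..R} = (\<integral>\<^sup>+\<rho>. c * (ennreal (\<rho> ^ (N - 1)) * indicator {0..R} \<rho>) \<partial>lborel)"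
      by (subst emeasure_density) (auto intro!: nn_integral_cong simp: indicator_def)
    also have "\<dots> = c * (\<integral>\<^sup>+\<rho>. ennreal (\<rho> ^ (N - 1)) * indicator {0..R} \<rho> \<partial>lborel)"
      by (rule nn_integral_cmult) measurable
    finally have *: "emeasure (?D c) {..R} = c * (\<integral>\<^sup>+\<rho>. ennreal (\<rho> ^ (N - 1)) * indicator {0..R} \<rho> \<partial>lborel)" .
    show ?thesis
    proof (cases "0 \<le> R")
      case True
      have "(\<integral>\<^sup>+\<rho>. ennreal (\<rho> ^ (N - 1)) * indicator {0..R} \<rho> \<partial>lborel) = ennreal (R ^ N / N - 0 ^ N / N)"
        by (rule nn_integral_FTC_Icc) (use True N in \<open>auto intro!: derivative_eq_intros\<close>)
      then show ?thesis
      proof -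
        assume I: "(\<integral>\<^sup>+\<rho>. ennreal (\<rho> ^ (N - 1)) * indicator {0..R} \<rho> \<partial>lborel) = ennreal (R ^ N / N - 0 ^ N / N)"
        have "emeasure (?D c) {..R} = (ennreal (real N) * ennreal (R ^ N / N)) * A"
          unfolding * I using N by (simp add: c_def power_0_left mult_ac)
        also have "ennreal (real N) * ennreal (R ^ N / N) = ennreal (R ^ N)"
          using N True by (simp flip: ennreal_mult)
        finally show ?thesis using True by simp
      qed
    next
      case False
      then show ?thesis unfolding * by simp
    qed
  qed
  have "?M = ?D c"
  proof (rule measure_eqI_generator_eq)
    let ?E = "range (\<lambda>a. {..a::real})"
    show "Int_stable ?E" by (auto simp: Int_stable_def)
    show "?E \<subseteq> Pow UNIV" by simp
    show "sets ?M = sigma_sets UNIV ?E" "sets (?D c) = sigma_sets UNIV ?E"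
      by (simp_all add: borel_eq_atMost)
    show "range (\<lambda>n::nat. {..real n}) \<subseteq> ?E" by auto
    show "(\<Union>n::nat. {..real n}) = UNIV" by (auto intro: real_arch_simple)
    show "emeasure ?M {..real n} \<noteq> \<infinity>" for n :: nat
      unfolding M using A by (auto simp: ennreal_mult_eq_top_iff)
    show "emeasure ?M X = emeasure (?D c) X" if "X \<in> ?E" for X
      using that M D by auto
  qed
  then show ?thesis by blast
qed

lemma integral_gauss_coord_power:
  fixes e :: "'d::finite"
  shows "has_bochner_integral lborel (\<lambda>k::real^'d. exp (- (norm k)\<^sup>2) * (k $ e) ^ (2 * j))
    (pi powr (real CARD('d) / 2) * pochhammer (1 / 2) j)"
proof -
  define f :: "'d \<Rightarrow> real \<Rightarrow> real" where "f = (\<lambda>i t. t ^ (2 * (if i = e then j else 0)) * exp (- t\<^sup>2))" 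
  have f: "has_bochner_integral lborel (f i) (sqrt pi * pochhammer (1 / 2) (if i = e then j else 0))" for i
    using gauss_moment_even[of 1 0 "if i = e then j else 0"] by (simp add: f_def)
  have F: "(\<Prod>i\<in>UNIV. f i (k $ i)) = exp (- (norm k)\<^sup>2) * (k $ e) ^ (2 * j)" for k :: "real^'d"
  proof -
    have "(\<Prod>i\<in>UNIV. (k $ i) ^ (2 * (if i = e then j else 0))) = (\<Prod>i\<in>UNIV. if i = e then (k $ e) ^ (2 * j) else 1)"
      by (intro prod.cong) auto
    then show ?thesis
      by (simp add: f_def prod.distrib norm_vec_sq flip: exp_sum sum_negf)
  qed
  have "(\<Prod>i\<in>(UNIV::'d set). pochhammer (1 / 2 :: real) (if i = e then j else 0))
      = (\<Prod>i\<in>(UNIV::'d set). if i = e then pochhammer (1 / 2) j else 1)"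
    by (intro prod.cong) auto
  then have "(\<Prod>i\<in>(UNIV::'d set). sqrt pi * pochhammer (1 / 2) (if i = e then j else 0))
      = pi powr (real CARD('d) / 2) * pochhammer (1 / 2) j"
    by (simp add: prod.distrib powr_half_sqrt[symmetric] powr_powr flip: powr_realpow)
  then show ?thesis
    using integrable_lborel_prod_vec[of f] integral_lborel_prod_vec[of f] f
    by (simp add: has_bochner_integral_iff F)
qed

text \<open>
  The integral of \<open>(\<theta> $ e) ^ (2 * j)\<close> over the unit sphere of \<open>d\<close>-dimensional space with
  respect to surface measure.
\<close>

definition polar_const :: "nat \<Rightarrow> nat \<Rightarrow> real" where
  "polar_const d j = 2 * pi powr (d / 2) * pochhammer (1 / 2) j / Gamma (real j + d / 2)"

lemma polar_const_nonneg: "0 < d \<Longrightarrow> 0 \<le> polar_const d j"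
  unfolding polar_const_def by (intro divide_nonneg_pos mult_nonneg_nonneg pochhammer_nonneg Gamma_real_pos) auto

text \<open>
  The constant left open by homogeneity is found by taking \<open>f \<rho> = exp (- \<rho>\<^sup>2)\<close>, for which the
  left-hand side factors over the coordinates.
\<close>

lemma nn_integral_polar_coord_power:
  fixes e :: "'d::finite" and f :: "real \<Rightarrow> ennreal"
  assumes [measurable]: "f \<in> borel_measurable borel"
  shows "(\<integral>\<^sup>+k. f (norm (k::real^'d)) * ennreal ((k $ e) ^ (2 * j)) \<partial>lborel) =
    ennreal (polar_const (CARD('d)) j) *
    (\<integral>\<^sup>+\<rho>. f \<rho> * ennreal (indicator {0..} \<rho> * \<rho> ^ (2 * j + CARD('d) - 1)) \<partial>lborel)"
proof -
  let ?N = "2 * j + CARD('d)"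
  obtain c where c: "distr (density lborel (\<lambda>k::real^'d. ennreal ((k $ e) ^ (2 * j)))) borel norm
     = density lborel (\<lambda>\<rho>. c * ennreal (indicator {0..} \<rho> * \<rho> ^ (?N - 1)))"
    using polar_moment_measure[where j = j and e = e] by blast
  have gen: "(\<integral>\<^sup>+k. f (norm (k::real^'d)) * ennreal ((k $ e) ^ (2 * j)) \<partial>lborel) =
    c * (\<integral>\<^sup>+\<rho>. f \<rho> * ennreal (indicator {0..} \<rho> * \<rho> ^ (?N - 1)) \<partial>lborel)"
    if [measurable]: "f \<in> borel_measurable borel" for f :: "real \<Rightarrow> ennreal"
  proof -
    have "(\<integral>\<^sup>+k. f (norm (k::real^'d)) * ennreal ((k $ e) ^ (2 * j)) \<partial>lborel)
      = (\<integral>\<^sup>+\<rho>. f \<rho> \<partial>distr (density lborel (\<lambda>k::real^'d. ennreal ((k $ e) ^ (2 * j)))) borel norm)"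
      by (simp add: nn_integral_distr nn_integral_density mult.commute)
    also have "\<dots> = (\<integral>\<^sup>+\<rho>. c * (f \<rho> * ennreal (indicator {0..} \<rho> * \<rho> ^ (?N - 1))) \<partial>lborel)"
      unfolding c by (simp add: nn_integral_density mult_ac)
    also have "\<dots> = c * (\<integral>\<^sup>+\<rho>. f \<rho> * ennreal (indicator {0..} \<rho> * \<rho> ^ (?N - 1)) \<partial>lborel)"
      by (rule nn_integral_cmult) measurable
    finally show ?thesis .
  qed
  have "(\<integral>\<^sup>+k. ennreal (exp (- (norm (k::real^'d))\<^sup>2)) * ennreal ((k $ e) ^ (2 * j)) \<partial>lborel)
      = ennreal (pi powr (real CARD('d) / 2) * pochhammer (1 / 2) j)"
    using integral_gauss_coord_power[of e j]
    by (simp add: has_bochner_integral_iff nn_integral_eq_integral flip: ennreal_mult)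
  moreover have "(\<integral>\<^sup>+\<rho>. ennreal (exp (- \<rho>\<^sup>2)) * ennreal (indicator {0..} \<rho> * \<rho> ^ (?N - 1)) \<partial>lborel)
      = ennreal (Gamma (real j + real CARD('d) / 2) / 2)"
  proof -
    have "(real (?N - 1) + 1) / 2 = real j + real CARD('d) / 2"
    proof -
      have "1 \<le> ?N" using zero_less_card_finite[where 'a='d] by linarith
      then have "real (?N - 1) = real ?N - 1" by (metis of_nat_diff of_nat_1)
      then show ?thesis by (simp add: field_simps)
    qed
    then have hb: "has_bochner_integral lborel (\<lambda>\<rho>::real. indicator {0..} \<rho> *\<^sub>R (exp (- \<rho>\<^sup>2) * \<rho> ^ (?N - 1)))
      (Gamma (real j + real CARD('d) / 2) / 2)"
      using gauss_half_moment[of "?N - 1"] by (simp only:)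
    have "(\<integral>\<^sup>+\<rho>. ennreal (exp (- \<rho>\<^sup>2)) * ennreal (indicator {0..} \<rho> * \<rho> ^ (?N - 1)) \<partial>lborel)
      = (\<integral>\<^sup>+\<rho>. ennreal (indicator {0..} \<rho> *\<^sub>R (exp (- \<rho>\<^sup>2) * \<rho> ^ (?N - 1))) \<partial>lborel)"
      by (intro nn_integral_cong) (auto simp: indicator_def simp flip: ennreal_mult)
    also have "\<dots> = ennreal (\<integral>\<rho>. indicator {0..} \<rho> *\<^sub>R (exp (- \<rho>\<^sup>2) * \<rho> ^ (?N - 1)) \<partial>lborel)"
      by (rule nn_integral_eq_integral[OF integrable.intros[OF hb]]) (auto simp: indicator_def)
    also have "\<dots> = ennreal (Gamma (real j + real CARD('d) / 2) / 2)"
      by (simp only: has_bochner_integral_integral_eq[OF hb])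
    finally show ?thesis .
  qed
  ultimately have eq: "ennreal (pi powr (real CARD('d) / 2) * pochhammer (1 / 2) j)
      = c * ennreal (Gamma (real j + real CARD('d) / 2) / 2)"
    using gen[of "\<lambda>\<rho>. ennreal (exp (- \<rho>\<^sup>2))"] by simp
  have G: "0 < Gamma (real j + real CARD('d) / 2)" by (intro Gamma_real_pos) (simp add: add_nonneg_pos)
  have "c = ennreal (polar_const (CARD('d)) j)"
  proof (cases c)
    case (real r)
    then have "pi powr (real CARD('d) / 2) * pochhammer (1 / 2) j = r * (Gamma (real j + real CARD('d) / 2) / 2)"
      using eq G pochhammer_nonneg[of "1/2::real" j] by (simp flip: ennreal_mult)
    then have "r = polar_const (CARD('d)) j" using G by (simp add: polar_const_def field_simps)
    then show ?thesis using real by simp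
  next
    case top
    then show ?thesis using eq G by (simp add: ennreal_top_mult)
  qed
  then show ?thesis using gen[OF assms] by simp
qed

text \<open>
  The entire function with \<open>I\<^sub>\<nu> (2 z) = z\<^sup>\<nu> bessel_series \<nu> z\<close> for \<open>z > 0\<close>. In contrast to
  \<^const>\<open>bessel_I\<close>, it takes the right value at \<open>z = 0\<close> for every \<open>\<nu>\<close>, so it serves \<open>p = 0\<close>
  and \<open>p > 0\<close> at the same time.
\<close>

definition bessel_series :: "real \<Rightarrow> real \<Rightarrow> real" where
  "bessel_series \<nu> z = (\<Sum>k. z ^ (2 * k) / fact k * rGamma (\<nu> + real k + 1))"

lemma bessel_I_eq: "bessel_I \<nu> w = (w / 2) powr \<nu> * bessel_series \<nu> (w / 2)"
  by (simp add: bessel_I_def bessel_series_def)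

text \<open>
  For \<open>\<nu> \<ge> - 1 / 2\<close> the first step of \<open>\<Gamma> (\<nu> + k + 1)\<close> multiplies by at least \<open>1 / 2\<close> and every
  later one by at least \<open>1\<close>. The value \<open>- 1 / 2\<close> occurs in dimension one.
\<close>

lemma rGamma_bound:
  assumes "- 1 / 2 \<le> \<nu>"
  shows "0 \<le> rGamma (\<nu> + real k + 1)" "rGamma (\<nu> + real k + 1) \<le> 2 * rGamma (\<nu> + 1)"
proof -
  have pos: "0 < Gamma (\<nu> + real k + 1)" for k
    using assms by (intro Gamma_real_pos) auto
  show "0 \<le> rGamma (\<nu> + real k + 1)"
    using pos[of k] by (simp add: rGamma_inverse_Gamma)
  have "Gamma (\<nu> + 1) / 2 \<le> Gamma (\<nu> + real k + 1)"
  proof (cases k)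
    case 0
    then show ?thesis using pos[of 0] by simp
  next
    case (Suc n)
    have "Gamma (\<nu> + 1) / 2 \<le> Gamma (\<nu> + real (Suc n) + 1)" for n
    proof (induction n)
      case 0
      have "Gamma (\<nu> + 1 + 1) = (\<nu> + 1) * Gamma (\<nu> + 1)"
        using assms by (intro Gamma_plus1) auto
      moreover have "1 / 2 * Gamma (\<nu> + 1) \<le> (\<nu> + 1) * Gamma (\<nu> + 1)"
        using assms pos[of 0] by (intro mult_right_mono) auto
      ultimately show ?case by simp
    next
      case (Suc n)
      have "Gamma (\<nu> + real (Suc n) + 1 + 1) = (\<nu> + real (Suc n) + 1) * Gamma (\<nu> + real (Suc n) + 1)"
        using assms by (intro Gamma_plus1) auto
      moreover have "1 * Gamma (\<nu> + real (Suc n) + 1) \<le> (\<nu> + real (Suc n) + 1) * Gamma (\<nu> + real (Suc n) + 1)"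
        using assms pos[of "Suc n"] by (intro mult_right_mono) auto
      ultimately show ?case using Suc by (simp add: add_ac)
    qed
    then show ?thesis using Suc by blast
  qed
  then have "1 / Gamma (\<nu> + real k + 1) \<le> 1 / (Gamma (\<nu> + 1) / 2)"
    using pos[of 0] by (intro divide_left_mono mult_pos_pos pos) auto
  then show "rGamma (\<nu> + real k + 1) \<le> 2 * rGamma (\<nu> + 1)"
    by (simp add: rGamma_inverse_Gamma inverse_eq_divide)
qed

lemma summable_bessel_series:
  assumes "- 1 / 2 \<le> \<nu>"
  shows "summable (\<lambda>k. z ^ (2 * k) / fact k * rGamma (\<nu> + real k + 1))"
proof (rule summable_comparison_test)
  show "\<exists>N. \<forall>k\<ge>N. norm (z ^ (2 * k) / fact k * rGamma (\<nu> + real k + 1)) \<le> (2 * rGamma (\<nu> + 1)) * (z\<^sup>2 ^ k /\<^sub>R fact k)"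
  proof (intro exI allI impI)
    fix k
    have "norm (z ^ (2 * k) / fact k * rGamma (\<nu> + real k + 1)) = z\<^sup>2 ^ k / fact k * rGamma (\<nu> + real k + 1)"
      using rGamma_bound(1)[OF assms, of k] unfolding power_mult by (simp add: abs_mult)
    also have "\<dots> \<le> z\<^sup>2 ^ k / fact k * (2 * rGamma (\<nu> + 1))"
      by (intro mult_left_mono rGamma_bound assms) auto
    finally show "norm (z ^ (2 * k) / fact k * rGamma (\<nu> + real k + 1)) \<le> (2 * rGamma (\<nu> + 1)) * (z\<^sup>2 ^ k /\<^sub>R fact k)"
      by (simp add: divide_inverse mult_ac)
  qed
  show "summable (\<lambda>k. (2 * rGamma (\<nu> + 1)) * (z\<^sup>2 ^ k /\<^sub>R fact k))"
    by (intro summable_mult summable_exp_generic)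
qed

lemma bessel_series_nonneg: "- 1 / 2 \<le> \<nu> \<Longrightarrow> 0 \<le> bessel_series \<nu> z"
  unfolding bessel_series_def by (intro suminf_nonneg summable_bessel_series) (auto simp: rGamma_bound)

lemma bessel_series_measurable [measurable]: "bessel_series \<nu> \<in> borel_measurable borel"
  unfolding bessel_series_def by measurable

lemma cosh_sums: "(\<lambda>j. x ^ (2 * j) / fact (2 * j)) sums cosh (x :: real)"
proof -
  have "(\<lambda>n. if even n then x ^ n /\<^sub>R fact n else 0) sums cosh x" by (rule cosh_converges)
  then have "(\<lambda>j. if even (2 * j) then x ^ (2 * j) /\<^sub>R fact (2 * j) else 0) sums cosh x"
    by (subst (asm) sums_mono_reindex[of "\<lambda>j. 2 * j", symmetric]) (auto simp: strict_mono_def elim!: evenE)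
  then show ?thesis by (simp add: divide_inverse mult.commute)
qed

lemma nn_integral_reflect:
  fixes f :: "'a::euclidean_space \<Rightarrow> ennreal"
  assumes "f \<in> borel_measurable borel"
  shows "(\<integral>\<^sup>+k. f (- k) \<partial>lborel) = (\<integral>\<^sup>+k. f k \<partial>lborel)"
  using nn_integral_lborel_affine[OF assms, of "- 1" 0] by simp

text \<open>
  The reflection \<open>k \<mapsto> - k\<close> preserves the norm, so the exponential may be replaced by its even
  part, whose power series has only non-negative terms.
\<close>

lemma nn_integral_radial_exp:
  fixes e :: "'d::finite" and F :: "real \<Rightarrow> real"
  assumes [measurable]: "F \<in> borel_measurable borel" and F: "\<And>\<rho>. 0 \<le> F \<rho>"
  shows "(\<integral>\<^sup>+k. ennreal (F (norm (k::real^'d)) * exp (a * k $ e)) \<partial>lborel) =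
    (\<integral>\<^sup>+k. ennreal (F (norm (k::real^'d)) * cosh (a * k $ e)) \<partial>lborel)"
proof -
  let ?I = "\<lambda>a. \<integral>\<^sup>+k. ennreal (F (norm (k::real^'d)) * exp (a * k $ e)) \<partial>lborel"
  have refl: "?I (- a) = ?I a"
    using nn_integral_reflect[of "\<lambda>k::real^'d. ennreal (F (norm k) * exp (a * k $ e))"] by simp
  have "(\<integral>\<^sup>+k. ennreal (F (norm (k::real^'d)) * cosh (a * k $ e)) \<partial>lborel) =
    (\<integral>\<^sup>+k. ennreal (1/2) * ennreal (F (norm (k::real^'d)) * exp (a * k $ e))
       + ennreal (1/2) * ennreal (F (norm k) * exp ((- a) * k $ e)) \<partial>lborel)"
    using F by (intro nn_integral_cong)
      (simp add: cosh_def algebra_simps flip: ennreal_mult ennreal_plus del: ennreal_half)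
  also have "\<dots> = ennreal (1/2) * ?I a + ennreal (1/2) * ?I (- a)"
    by (subst nn_integral_add) (simp_all add: nn_integral_cmult)
  also have "\<dots> = (ennreal (1/2) + ennreal (1/2)) * ?I a"
    unfolding refl by (simp only: distrib_right)
  also have "ennreal (1/2) + ennreal (1/2) = 1"
    by (subst ennreal_plus[symmetric]) auto
  finally show ?thesis by simp
qed

text \<open>
  The factor \<open>(2j)!\<close> of the hyperbolic cosine cancels against the one in \<open>pochhammer (1/2) j\<close>,
  which leaves exactly a term of the Bessel series at \<open>a * \<rho> / 2\<close>.
\<close>

lemma polar_const_bessel_coeff:
  assumes "0 < d"
  shows "a ^ (2 * j) / fact (2 * j) * polar_const d j * \<rho> ^ (2 * j) =
    2 * pi powr (d / 2) * ((a * \<rho> / 2) ^ (2 * j) / fact j * rGamma (real d / 2 - 1 + real j + 1))"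
proof -
  have "polar_const d j = 2 * pi powr (d / 2) * (fact (2 * j) / (4 ^ j * fact j)) * rGamma (real d / 2 + real j)"
    by (simp add: polar_const_def pochhammer_half rGamma_inverse_Gamma inverse_eq_divide add.commute)
  moreover have "(a * \<rho> / 2) ^ (2 * j) = a ^ (2 * j) * \<rho> ^ (2 * j) / 4 ^ j"
    by (simp add: power_divide power_mult_distrib power_mult)
  ultimately show ?thesis by simp
qed

text \<open>
  Everything is non-negative, so sums and integrals may be exchanged freely in the extended
  non-negative reals. The identity of Bochner integrals that results covers the divergent
  case too, where both sides take the default value zero.
\<close>

lemma integral_radial_exp:
  fixes e :: "'d::finite" and F :: "real \<Rightarrow> real"
  assumes [measurable]: "F \<in> borel_measurable borel" and F: "\<And>\<rho>. 0 \<le> F \<rho>"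
  shows "(\<integral>k. F (norm (k::real^'d)) * exp (a * k $ e) \<partial>lborel) =
    2 * pi powr (real CARD('d) / 2) *
    (LBINT \<rho>:{0..}. \<rho> ^ (CARD('d) - 1) * F \<rho> * bessel_series (real CARD('d) / 2 - 1) (a * \<rho> / 2))"
proof -
  let ?d = "(CARD('d))" and ?\<nu> = "real CARD('d) / 2 - 1"
  have d: "0 < ?d" by simp
  have \<nu>: "- 1 / 2 \<le> ?\<nu>" using d by (simp add: field_simps del: zero_less_card_finite)
  have "(\<integral>\<^sup>+k. ennreal (F (norm (k::real^'d)) * exp (a * k $ e)) \<partial>lborel)
    = (\<integral>\<^sup>+k. (\<Sum>j. ennreal (a ^ (2 * j) / fact (2 * j)) * (ennreal (F (norm (k::real^'d))) * ennreal ((k $ e) ^ (2 * j)))) \<partial>lborel)"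
    unfolding nn_integral_radial_exp[OF assms]
  proof (intro nn_integral_cong)
    fix k :: "real^'d"
    have "(\<lambda>j. F (norm k) * ((a * k $ e) ^ (2 * j) / fact (2 * j))) sums (F (norm k) * cosh (a * k $ e))"
      by (intro sums_mult cosh_sums)
    then have "(\<Sum>j. ennreal (F (norm k) * ((a * k $ e) ^ (2 * j) / fact (2 * j)))) = ennreal (F (norm k) * cosh (a * k $ e))"
      using F by (intro suminf_ennreal_eq) auto
    moreover have "ennreal (F (norm k) * ((a * k $ e) ^ (2 * j) / fact (2 * j)))
        = ennreal (a ^ (2 * j) / fact (2 * j)) * (ennreal (F (norm k)) * ennreal ((k $ e) ^ (2 * j)))" for j
    proof -
      have "F (norm k) * ((a * k $ e) ^ (2 * j) / fact (2 * j)) = a ^ (2 * j) / fact (2 * j) * (F (norm k) * (k $ e) ^ (2 * j))"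
        by (simp add: power_mult_distrib)
      then show ?thesis
        using F[of "norm k"] zero_le_even_power[of "2 * j" a] zero_le_even_power[of "2 * j" "k $ e"]
        by (simp only: ennreal_mult mult_nonneg_nonneg divide_nonneg_pos fact_gt_zero even_mult_iff even_numeral simp_thms)
    qed
    ultimately show "ennreal (F (norm k) * cosh (a * k $ e)) =
      (\<Sum>j. ennreal (a ^ (2 * j) / fact (2 * j)) * (ennreal (F (norm k)) * ennreal ((k $ e) ^ (2 * j))))" by simp
  qed
  also have "\<dots> = (\<Sum>j. ennreal (a ^ (2 * j) / fact (2 * j)) * (\<integral>\<^sup>+k. ennreal (F (norm (k::real^'d))) * ennreal ((k $ e) ^ (2 * j)) \<partial>lborel))"
    by (simp add: nn_integral_suminf nn_integral_cmult)
  also have "\<dots> = (\<Sum>j. \<integral>\<^sup>+\<rho>. ennreal (a ^ (2 * j) / fact (2 * j)) * (ennreal (polar_const ?d j) *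
       (ennreal (F \<rho>) * ennreal (indicator {0..} \<rho> * \<rho> ^ (2 * j + ?d - 1)))) \<partial>lborel)"
    by (simp add: nn_integral_polar_coord_power[where f="\<lambda>\<rho>. ennreal (F \<rho>)"] nn_integral_cmult)
  also have "\<dots> = (\<integral>\<^sup>+\<rho>. (\<Sum>j. ennreal (a ^ (2 * j) / fact (2 * j)) * (ennreal (polar_const ?d j) *
       (ennreal (F \<rho>) * ennreal (indicator {0..} \<rho> * \<rho> ^ (2 * j + ?d - 1))))) \<partial>lborel)"
    by (subst nn_integral_suminf) auto
  also have "\<dots> = (\<integral>\<^sup>+\<rho>. ennreal (2 * pi powr (?d / 2) * (indicator {0..} \<rho> *\<^sub>R (\<rho> ^ (?d - 1) * F \<rho> * bessel_series ?\<nu> (a * \<rho> / 2)))) \<partial>lborel)"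
  proof (intro nn_integral_cong)
    fix \<rho> :: real
    define I where "I = indicator {0..} \<rho> * \<rho> ^ (?d - 1)"
    have I: "0 \<le> I" by (simp add: I_def indicator_def)
    let ?t = "\<lambda>j. F \<rho> * I * (2 * pi powr (?d / 2) * ((a * \<rho> / 2) ^ (2 * j) / fact j * rGamma (?\<nu> + real j + 1)))"
    have t_nonneg: "0 \<le> ?t j" for j
      by (intro mult_nonneg_nonneg divide_nonneg_pos rGamma_bound \<nu> F I) auto
    have "?t sums (F \<rho> * I * (2 * pi powr (?d / 2) * bessel_series ?\<nu> (a * \<rho> / 2)))"
      unfolding bessel_series_def by (intro sums_mult summable_sums summable_bessel_series \<nu>)
    then have "(\<Sum>j. ennreal (?t j)) = ennreal (F \<rho> * I * (2 * pi powr (?d / 2) * bessel_series ?\<nu> (a * \<rho> / 2)))"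
      by (intro suminf_ennreal_eq t_nonneg)
    moreover have "ennreal (?t j) = ennreal (a ^ (2 * j) / fact (2 * j)) * (ennreal (polar_const ?d j) *
       (ennreal (F \<rho>) * ennreal (indicator {0..} \<rho> * \<rho> ^ (2 * j + ?d - 1))))" for j
    proof -
      have "indicator {0..} \<rho> * \<rho> ^ (2 * j + ?d - 1) = I * \<rho> ^ (2 * j)"
      proof -
        have "2 * j + ?d - 1 = (?d - 1) + 2 * j" using d by linarith
        then show ?thesis unfolding I_def by (simp only: power_add mult.assoc)
      qed
      moreover have "0 \<le> I * \<rho> ^ (2 * j)" using I by simp
      moreover have "?t j = a ^ (2 * j) / fact (2 * j) * (polar_const ?d j * (F \<rho> * (I * \<rho> ^ (2 * j))))"
        unfolding polar_const_bessel_coeff[OF d, symmetric] by (simp only: mult_ac)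
      ultimately show ?thesis
        using F[of \<rho>] polar_const_nonneg[OF d, of j] zero_le_even_power[of "2 * j" a]
        by (simp only: ennreal_mult mult_nonneg_nonneg divide_nonneg_pos fact_gt_zero even_mult_iff even_numeral simp_thms)
    qed
    moreover have "F \<rho> * I * (2 * pi powr (?d / 2) * bessel_series ?\<nu> (a * \<rho> / 2))
       = 2 * pi powr (?d / 2) * (indicator {0..} \<rho> *\<^sub>R (\<rho> ^ (?d - 1) * F \<rho> * bessel_series ?\<nu> (a * \<rho> / 2)))"
      by (simp add: I_def)
    ultimately show "(\<Sum>j. ennreal (a ^ (2 * j) / fact (2 * j)) * (ennreal (polar_const ?d j) *
       (ennreal (F \<rho>) * ennreal (indicator {0..} \<rho> * \<rho> ^ (2 * j + ?d - 1))))) =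
       ennreal (2 * pi powr (?d / 2) * (indicator {0..} \<rho> *\<^sub>R (\<rho> ^ (?d - 1) * F \<rho> * bessel_series ?\<nu> (a * \<rho> / 2))))"
      by simp
  qed
  finally have nn: "(\<integral>\<^sup>+k. ennreal (F (norm (k::real^'d)) * exp (a * k $ e)) \<partial>lborel) = \<dots>" .
  have "(\<integral>k. F (norm (k::real^'d)) * exp (a * k $ e) \<partial>lborel)
    = enn2real (\<integral>\<^sup>+k. ennreal (F (norm (k::real^'d)) * exp (a * k $ e)) \<partial>lborel)"
    using F by (intro integral_eq_nn_integral) auto
  also have "\<dots> = (\<integral>\<rho>. 2 * pi powr (?d / 2) * (indicator {0..} \<rho> *\<^sub>R (\<rho> ^ (?d - 1) * F \<rho> * bessel_series ?\<nu> (a * \<rho> / 2))) \<partial>lborel)"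
    unfolding nn using F bessel_series_nonneg[OF \<nu>]
    by (intro integral_eq_nn_integral[symmetric]) (auto simp: indicator_def intro!: mult_nonneg_nonneg)
  finally show ?thesis by (simp add: set_lebesgue_integral_def)
qed

section \<open>The integral formulas and the limit at \<open>p = 0\<close>\<close>

lemma norm_diff_axis_sq:
  fixes k :: "real^'d::finite"
  shows "(norm (k - p *\<^sub>R axis e 1))\<^sup>2 = (norm k)\<^sup>2 - 2 * p * k $ e + p\<^sup>2"
  unfolding power2_norm_eq_inner
  by (simp add: inner_diff_left inner_diff_right inner_axis inner_axis' power2_eq_square algebra_simps)

lemma H_norm_gauss_wave_radial:
  fixes e :: "'d::finite"
  assumes m: "0 \<le> m" and s: "0 < \<sigma>"
  shows "(H_norm m (gauss_wave e p \<sigma>))\<^sup>2 = 2 * pi powr (real CARD('d) / 2) / \<sigma> ^ CARD('d) *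
    (LBINT \<rho>:{0..}. \<rho> ^ (CARD('d) - 1) * ((1 + \<rho>\<^sup>2) powr m * exp (- ((\<rho>\<^sup>2 + p\<^sup>2) / \<sigma>))) *
       bessel_series (real CARD('d) / 2 - 1) (p * \<rho> / \<sigma>))"
proof -
  let ?F = "\<lambda>\<rho>. (1 + \<rho>\<^sup>2) powr m * exp (- ((\<rho>\<^sup>2 + p\<^sup>2) / \<sigma>))"
  have eq: "(1 + (norm k)\<^sup>2) powr m * exp (- ((norm (k - p *\<^sub>R axis e 1))\<^sup>2 / \<sigma>)) = ?F (norm k) * exp (2 * p / \<sigma> * k $ e)"
    for k :: "real^'d"
    unfolding norm_diff_axis_sq mult.assoc exp_add[symmetric]
    using s by (simp add: diff_divide_distrib add_divide_distrib)
  have arg: "2 * p / \<sigma> * \<rho> / 2 = p * \<rho> / \<sigma>" for \<rho> by simp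
  have "(\<integral>k. ?F (norm k) * exp (2 * p / \<sigma> * (k :: real^'d) $ e) \<partial>lborel) = 2 * pi powr (real CARD('d) / 2) *
    (LBINT \<rho>:{0..}. \<rho> ^ (CARD('d) - 1) * ?F \<rho> * bessel_series (real CARD('d) / 2 - 1) (p * \<rho> / \<sigma>))"
    unfolding arg[symmetric] by (rule integral_radial_exp) auto
  then show ?thesis
    unfolding H_norm_gauss_wave[OF m s] eq by simp
qed

text \<open>
  For \<open>\<rho> > 0\<close> the power \<open>\<rho> ^ (d - 1)\<close> splits into \<open>\<rho> powr (d / 2)\<close> and the factor
  \<open>\<rho> powr (d / 2 - 1)\<close> that turns the Bessel series into \<^const>\<open>bessel_I\<close>.
\<close>

lemma H_norm_gauss_wave_bessel:
  fixes e :: "'d::finite"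
  assumes m: "0 \<le> m" and s: "0 < \<sigma>" and p: "0 < p"
  defines "d \<equiv> CARD('d)"
  shows "(H_norm m (gauss_wave e p \<sigma>))\<^sup>2 =
    2 * pi powr (d / 2) / (\<sigma> powr (d / 2 + 1) * p powr (d / 2 - 1)) *
    (LBINT \<rho>:{0..}. \<rho> powr (d / 2) * (1 + \<rho>\<^sup>2) powr m * exp (- ((\<rho>\<^sup>2 + p\<^sup>2) / \<sigma>)) *
       bessel_I (d / 2 - 1) (2 * p / \<sigma> * \<rho>))"
proof -
  let ?c = "(p / \<sigma>) powr (real d / 2 - 1)"
  let ?g = "\<lambda>\<rho>. \<rho> ^ (d - 1) * ((1 + \<rho>\<^sup>2) powr m * exp (- ((\<rho>\<^sup>2 + p\<^sup>2) / \<sigma>))) * bessel_series (d / 2 - 1) (p * \<rho> / \<sigma>)"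
  have d: "1 \<le> d" using zero_less_card_finite[where 'a='d] unfolding d_def by linarith
  have pt: "\<rho> powr (d / 2) * (1 + \<rho>\<^sup>2) powr m * exp (- ((\<rho>\<^sup>2 + p\<^sup>2) / \<sigma>)) * bessel_I (d / 2 - 1) (2 * p / \<sigma> * \<rho>)
      = ?c * ?g \<rho>" if \<rho>: "0 < \<rho>" for \<rho>
  proof -
    have "\<rho> ^ (d - 1) = \<rho> powr (real d / 2 + (real d / 2 - 1))"
      using d \<rho> by (simp add: powr_realpow[symmetric] of_nat_diff)
    also have "\<dots> = \<rho> powr (d / 2) * \<rho> powr (d / 2 - 1)" by (rule powr_add)
    finally have 1: "\<rho> ^ (d - 1) = \<rho> powr (d / 2) * \<rho> powr (d / 2 - 1)" .
    have w: "2 * p / \<sigma> * \<rho> / 2 = p / \<sigma> * \<rho>" by simp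
    have 2: "bessel_I (d / 2 - 1) (2 * p / \<sigma> * \<rho>) = ?c * \<rho> powr (d / 2 - 1) * bessel_series (d / 2 - 1) (p * \<rho> / \<sigma>)"
      unfolding bessel_I_eq w using s p \<rho> by (simp only: powr_mult) simp
    show ?thesis unfolding 1 2 by (simp only: mult_ac)
  qed
  have "(LBINT \<rho>:{0..}. \<rho> powr (d / 2) * (1 + \<rho>\<^sup>2) powr m * exp (- ((\<rho>\<^sup>2 + p\<^sup>2) / \<sigma>)) * bessel_I (d / 2 - 1) (2 * p / \<sigma> * \<rho>))
      = (LBINT \<rho>:{0..}. ?c * ?g \<rho>)"
    unfolding set_lebesgue_integral_def
  \<comment> \<open>At \<open>\<rho> = 0\<close> the integrands may differ, since \<open>0 powr x = 0\<close> for all \<open>x\<close>.\<close>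
  proof (rule integral_discrete_difference[of "{0}"])
    fix \<rho> :: real assume "\<rho> \<notin> {0}"
    then consider "0 < \<rho>" | "\<rho> < 0" by force
    then show "indicator {0..} \<rho> *\<^sub>R (\<rho> powr (d / 2) * (1 + \<rho>\<^sup>2) powr m * exp (- ((\<rho>\<^sup>2 + p\<^sup>2) / \<sigma>)) *
        bessel_I (d / 2 - 1) (2 * p / \<sigma> * \<rho>)) = indicator {0..} \<rho> *\<^sub>R (?c * ?g \<rho>)"
      by cases (simp_all only: pt, simp)
  qed auto
  also have "\<dots> = ?c * (LBINT \<rho>:{0..}. ?g \<rho>)" by simp
  finally have I: "(LBINT \<rho>:{0..}. \<rho> powr (d / 2) * (1 + \<rho>\<^sup>2) powr m * exp (- ((\<rho>\<^sup>2 + p\<^sup>2) / \<sigma>)) * bessel_I (d / 2 - 1) (2 * p / \<sigma> * \<rho>))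
      = ?c * (LBINT \<rho>:{0..}. ?g \<rho>)" .
  have "\<sigma> powr (d / 2 - 1) * \<sigma> powr (d / 2 + 1) = \<sigma> powr (real d / 2 - 1 + (real d / 2 + 1))"
    by (rule powr_add[symmetric])
  also have "\<dots> = \<sigma> ^ d" using s by (simp add: powr_realpow)
  finally have C: "?c / (\<sigma> powr (d / 2 + 1) * p powr (d / 2 - 1)) = 1 / \<sigma> ^ d"
    using s p by (simp add: powr_divide)
  have assoc: "a / x * (c * L) = a * (c / x) * L" for a x c L :: real by simp
  show ?thesis
    unfolding I H_norm_gauss_wave_radial[OF m s] d_def[symmetric] assoc C by simp
qed

lemma bessel_series_0: "bessel_series \<nu> 0 = rGamma (\<nu> + 1)"
  unfolding bessel_series_def by (subst suminf_finite[of "{0}"]) auto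

lemma H_norm_gauss_wave_0:
  fixes e :: "'d::finite"
  assumes m: "0 \<le> m" and s: "0 < \<sigma>"
  defines "d \<equiv> CARD('d)"
  shows "(H_norm m (gauss_wave e 0 \<sigma>))\<^sup>2 =
    2 * pi powr (d / 2) / (Gamma (d / 2) * \<sigma> ^ d) *
    (LBINT \<rho>:{0..}. \<rho> ^ (d - 1) * (1 + \<rho>\<^sup>2) powr m * exp (- (\<rho>\<^sup>2 / \<sigma>)))"
  unfolding H_norm_gauss_wave_radial[OF m s] d_def[symmetric]
  by (simp add: bessel_series_0 rGamma_inverse_Gamma mult.assoc[symmetric] inverse_eq_divide)

text \<open>
  Moving the centre of the Gaussian by at most \<open>K\<close> is paid for by doubling its variance and a
  constant factor, since \<open>|k|\<^sup>2 \<le> 2 |k - c|\<^sup>2 + 2 K\<^sup>2\<close> whenever \<open>|c| \<le> K\<close>; this gives an integrable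
  bound along any sequence \<open>p \<rightarrow> 0\<close>.
\<close>

lemma H_norm_gauss_wave_tendsto:
  fixes e :: "'d::finite"
  assumes m: "0 \<le> m" and s: "0 < \<sigma>"
  shows "((\<lambda>p. (H_norm m (gauss_wave e p \<sigma>))\<^sup>2) \<longlongrightarrow> (H_norm m (gauss_wave e 0 \<sigma>))\<^sup>2) (at_right 0)"
  unfolding tendsto_at_iff_sequentially comp_def
proof (intro allI impI)
  fix X :: "nat \<Rightarrow> real" assume "\<forall>i. X i \<in> {0<..} - {0}" and X: "X \<longlonglongrightarrow> 0"
  obtain K where K: "\<And>n. \<bar>X n\<bar> \<le> K"
    using convergent_imp_Bseq[OF convergentI[OF X]] by (auto simp: Bseq_def)
  let ?f = "\<lambda>p k::real^'d. (1 + (norm k)\<^sup>2) powr m * exp (- ((norm (k - p *\<^sub>R axis e 1))\<^sup>2 / \<sigma>))"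
  let ?w = "\<lambda>k::real^'d. exp (K\<^sup>2 / \<sigma>) * ((1 + (norm k)\<^sup>2) powr m * exp (- ((norm (k - 0))\<^sup>2 / (2 * \<sigma>))))"
  have "(\<lambda>n. \<integral>k. ?f (X n) k \<partial>lborel) \<longlonglongrightarrow> (\<integral>k. ?f 0 k \<partial>lborel)"
  proof (rule integral_dominated_convergence[where w="?w"])
    show "integrable lborel ?w"
      using s by (intro integrable_mult_right weighted_gauss_integrable m) simp
    show "AE k in lborel. (\<lambda>n. ?f (X n) k) \<longlonglongrightarrow> ?f 0 k"
      using s by (intro AE_I2 tendsto_intros X) auto
    show "AE k in lborel. norm (?f (X n) k) \<le> ?w k" for n
    proof (rule AE_I2)
      fix k :: "real^'d"
      let ?c = "X n *\<^sub>R axis e 1 :: real^'d"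
      have "(norm k)\<^sup>2 \<le> 2 * (norm (k - ?c))\<^sup>2 + 2 * K\<^sup>2"
      proof -
        have nc: "norm ?c \<le> K" using K[of n] by (simp add: norm_Basis axis_in_Basis_iff)
        have "norm k \<le> norm (k - ?c) + norm ?c" by (metis diff_add_cancel norm_triangle_ineq)
        also have "\<dots> \<le> norm (k - ?c) + K" using nc by simp
        finally have "(norm k)\<^sup>2 \<le> (norm (k - ?c) + K)\<^sup>2" by (intro power_mono) auto
        also have "\<dots> \<le> 2 * (norm (k - ?c))\<^sup>2 + 2 * K\<^sup>2"
          using sum_squares_bound[of "norm (k - ?c)" K] by (simp add: power2_sum)
        finally show ?thesis .
      qed
      then have "- ((norm (k - ?c))\<^sup>2 / \<sigma>) \<le> K\<^sup>2 / \<sigma> - (norm k)\<^sup>2 / (2 * \<sigma>)"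
        using s by (simp add: field_simps)
      then have "exp (- ((norm (k - ?c))\<^sup>2 / \<sigma>)) \<le> exp (K\<^sup>2 / \<sigma>) * exp (- ((norm (k - 0))\<^sup>2 / (2 * \<sigma>)))"
        by (simp flip: exp_add)
      then have "(1 + (norm k)\<^sup>2) powr m * exp (- ((norm (k - ?c))\<^sup>2 / \<sigma>))
          \<le> (1 + (norm k)\<^sup>2) powr m * (exp (K\<^sup>2 / \<sigma>) * exp (- ((norm (k - 0))\<^sup>2 / (2 * \<sigma>))))"
        by (intro mult_left_mono) auto
      then show "norm (?f (X n) k) \<le> ?w k" by (simp add: mult_ac)
    qed
  qed measurable
  then show "(\<lambda>n. (H_norm m (gauss_wave e (X n) \<sigma>))\<^sup>2) \<longlonglongrightarrow> (H_norm m (gauss_wave e 0 \<sigma>))\<^sup>2"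
    unfolding H_norm_gauss_wave[OF m s] using s by (intro tendsto_intros) auto
qed

text \<open>
  The Bessel series is an everywhere convergent power series in \<open>z\<^sup>2\<close>, hence continuous.
\<close>

lemma bessel_series_tendsto_0:
  assumes "- 1 / 2 \<le> \<nu>"
  shows "(bessel_series \<nu> \<longlongrightarrow> rGamma (\<nu> + 1)) (at 0)"
proof -
  define c where "c k = rGamma (\<nu> + real k + 1) / fact k" for k
  have eq: "z ^ (2 * k) / fact k * rGamma (\<nu> + real k + 1) = c k * (z\<^sup>2) ^ k" for z k
    by (simp add: c_def power_mult)
  have sm: "summable (\<lambda>k. c k * y ^ k)" for y :: real
  proof (rule summable_norm_cancel)
    have "summable (\<lambda>k. c k * ((sqrt \<bar>y\<bar>)\<^sup>2) ^ k)"
      using summable_bessel_series[OF assms, of "sqrt \<bar>y\<bar>"] unfolding eq .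
    then show "summable (\<lambda>k. norm (c k * y ^ k))"
      using rGamma_bound(1)[OF assms] by (simp add: c_def abs_mult power_abs)
  qed
  have "isCont (\<lambda>x. \<Sum>k. c k * x ^ k) (0\<^sup>2)"
    by (rule isCont_powser_converges_everywhere) (rule sm)
  then have "isCont (\<lambda>z. \<Sum>k. c k * (z\<^sup>2) ^ k) 0"
    by (intro isCont_o2[where f = "\<lambda>z::real. z\<^sup>2" and g = "\<lambda>x. \<Sum>k. c k * x ^ k"]) auto
  then have "isCont (bessel_series \<nu>) 0"
    unfolding bessel_series_def[abs_def] eq .
  then show ?thesis by (simp add: isCont_def bessel_series_0)
qed

lemma bessel_I_asymp_equiv:
  assumes \<nu>: "- 1 / 2 \<le> \<nu>"
  shows "bessel_I \<nu> \<sim>[at_right 0] (\<lambda>w. (w / 2) powr \<nu> / Gamma (\<nu> + 1))"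
proof (rule asymp_equivI')
  have G: "0 < Gamma (\<nu> + 1)" using \<nu> by (intro Gamma_real_pos) auto
  have "filterlim (\<lambda>w::real. w / 2) (at 0) (at_right 0)"
    unfolding filterlim_at by (auto intro!: tendsto_eq_intros simp: eventually_at_right_less eventually_at_filter)
  then have "((\<lambda>w. bessel_series \<nu> (w / 2)) \<longlongrightarrow> rGamma (\<nu> + 1)) (at_right 0)"
    by (rule filterlim_compose[OF bessel_series_tendsto_0[OF \<nu>]])
  then have "((\<lambda>w. bessel_series \<nu> (w / 2) * Gamma (\<nu> + 1)) \<longlongrightarrow> rGamma (\<nu> + 1) * Gamma (\<nu> + 1)) (at_right 0)"
    by (intro tendsto_intros)
  moreover have "rGamma (\<nu> + 1) * Gamma (\<nu> + 1) = 1"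
    using G by (simp add: rGamma_inverse_Gamma)
  moreover have "eventually (\<lambda>w. bessel_series \<nu> (w / 2) * Gamma (\<nu> + 1) = bessel_I \<nu> w / ((w / 2) powr \<nu> / Gamma (\<nu> + 1))) (at_right 0)"
    using eventually_at_right_less[of "0::real"] by eventually_elim (simp add: bessel_I_eq)
  ultimately show "((\<lambda>w. bessel_I \<nu> w / ((w / 2) powr \<nu> / Gamma (\<nu> + 1))) \<longlongrightarrow> 1) (at_right 0)"
    by (simp add: tendsto_cong)
qed

section \<open>Integer exponents\<close>

text \<open>
  The moments of \<open>\<Sum>i\<in>S. (k $ i)\<^sup>2\<close> are found by adding one coordinate at a time. The factors
  \<open>g i\<close> with \<open>i \<notin> S\<close> are arbitrary so that the power of the new coordinate, which comes from the
  binomial theorem, can be absorbed into its factor before the induction hypothesis is applied. The resulting sum of products of Pochhammer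
  symbols at \<open>|S| / 2\<close> and at \<open>1 / 2\<close> is Vandermonde's.
\<close>

lemma gauss_partial_radius_moment:
  fixes g :: "'d::finite \<Rightarrow> real \<Rightarrow> real"
  assumes s: "0 < s" and "\<And>i. i \<in> S \<Longrightarrow> g i = (\<lambda>t. exp (- (t\<^sup>2 / s)))"
    and "\<And>i. i \<notin> S \<Longrightarrow> integrable lborel (g i)"
  shows "has_bochner_integral lborel (\<lambda>k::real^'d. (\<Sum>i\<in>S. (k $ i)\<^sup>2) ^ n * (\<Prod>i\<in>UNIV. g i (k $ i)))
    (sqrt (pi * s) ^ card S * s ^ n * pochhammer (real (card S) / 2) n * (\<Prod>i\<in>- S. integral\<^sup>L lborel (g i)))"
  using finite[of S] assms(2,3)
proof (induction S arbitrary: g n rule: finite_induct)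
  case empty
  then show ?case
    using integrable_lborel_prod_vec[of g] integral_lborel_prod_vec[of g]
    by (cases n) (auto simp: has_bochner_integral_iff pochhammer_0_left)
next
  case (insert a S)
  define h where "h r = g(a := (\<lambda>t. t ^ (2 * r) * exp (- (t\<^sup>2 / s))))" for r
  let ?P = "\<Prod>i\<in>- insert a S. integral\<^sup>L lborel (g i)"
  let ?c = "\<lambda>S n. sqrt (pi * s) ^ card S * s ^ n * pochhammer (real (card S) / 2) n"
  have ha: "has_bochner_integral lborel (h r a) (sqrt (pi * s) * s ^ r * pochhammer (1 / 2) r)" for r
    using gauss_moment_even[OF s, of 0 r] by (simp add: h_def)
  have IH: "has_bochner_integral lborel (\<lambda>k::real^'d. (\<Sum>i\<in>S. (k $ i)\<^sup>2) ^ r * (\<Prod>i\<in>UNIV. h q i (k $ i)))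
     (?c S r * ((sqrt (pi * s) * s ^ q * pochhammer (1 / 2) q) * ?P))" for r q
  proof -
    have "(\<Prod>i\<in>- S. integral\<^sup>L lborel (h q i)) = integral\<^sup>L lborel (h q a) * (\<Prod>i\<in>- S - {a}. integral\<^sup>L lborel (h q i))"
      using insert.hyps by (intro prod.remove) auto
    also have "(\<Prod>i\<in>- S - {a}. integral\<^sup>L lborel (h q i)) = ?P"
      by (intro prod.cong) (auto simp: h_def)
    also have "integral\<^sup>L lborel (h q a) = sqrt (pi * s) * s ^ q * pochhammer (1 / 2) q"
      using ha by (rule has_bochner_integral_integral_eq)
    finally have P: "(\<Prod>i\<in>- S. integral\<^sup>L lborel (h q i)) = (sqrt (pi * s) * s ^ q * pochhammer (1 / 2) q) * ?P" .
    show ?thesis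
      unfolding P[symmetric]
    proof (rule insert.IH)
      show "h q i = (\<lambda>t. exp (- (t\<^sup>2 / s)))" if "i \<in> S" for i
        using that insert.hyps insert.prems(1)[of i] by (auto simp: h_def)
      show "integrable lborel (h q i)" if "i \<notin> S" for i
        using that insert.prems(2)[of i] integrable.intros[OF ha] by (cases "i = a") (auto simp: h_def)
    qed
  qed
  have "has_bochner_integral lborel
    (\<lambda>k::real^'d. \<Sum>r\<le>n. real (n choose r) * ((\<Sum>i\<in>S. (k $ i)\<^sup>2) ^ r * (\<Prod>i\<in>UNIV. h (n - r) i (k $ i))))
    (\<Sum>r\<le>n. real (n choose r) * (?c S r * ((sqrt (pi * s) * s ^ (n - r) * pochhammer (1 / 2) (n - r)) * ?P)))"
    by (intro has_bochner_integral_sum has_bochner_integral_mult_right IH)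
  moreover have "(\<Sum>r\<le>n. real (n choose r) * ((\<Sum>i\<in>S. (k $ i)\<^sup>2) ^ r * (\<Prod>i\<in>UNIV. h (n - r) i (k $ i))))
      = (\<Sum>i\<in>insert a S. (k $ i)\<^sup>2) ^ n * (\<Prod>i\<in>UNIV. g i (k $ i))" for k :: "real^'d"
  proof -
    have hk: "(\<Prod>i\<in>UNIV. h r i (k $ i)) = ((k $ a)\<^sup>2) ^ r * (\<Prod>i\<in>UNIV. g i (k $ i))" for r
    proof -
      have "(\<Prod>i\<in>UNIV. h r i (k $ i)) = (\<Prod>i\<in>UNIV. (if i = a then ((k $ a)\<^sup>2) ^ r else 1) * g i (k $ i))"
        using insert.prems(1)[of a] by (intro prod.cong) (auto simp: h_def power_mult)
      then show ?thesis by (simp add: prod.distrib)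
    qed
    have "(\<Sum>i\<in>insert a S. (k $ i)\<^sup>2) ^ n = ((\<Sum>i\<in>S. (k $ i)\<^sup>2) + (k $ a)\<^sup>2) ^ n"
      using insert.hyps by (simp add: add.commute)
    also have "\<dots> = (\<Sum>r\<le>n. real (n choose r) * (\<Sum>i\<in>S. (k $ i)\<^sup>2) ^ r * ((k $ a)\<^sup>2) ^ (n - r))"
      by (rule binomial_ring)
    finally show ?thesis unfolding hk by (simp add: sum_distrib_right mult.assoc)
  qed
  moreover have "(\<Sum>r\<le>n. real (n choose r) * (?c S r * ((sqrt (pi * s) * s ^ (n - r) * pochhammer (1 / 2) (n - r)) * ?P)))
      = ?c (insert a S) n * ?P"
  proof -
    have "real (n choose r) * (?c S r * ((sqrt (pi * s) * s ^ (n - r) * pochhammer (1 / 2) (n - r)) * ?P))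
      = (sqrt (pi * s) ^ Suc (card S) * s ^ n * ?P) *
        (real (n choose r) * pochhammer (real (card S) / 2) r * pochhammer (1 / 2) (n - r))" if "r \<le> n" for r
    proof -
      have "s ^ n = s ^ r * s ^ (n - r)" using that by (simp flip: power_add)
      then show ?thesis by (simp only: mult_ac power_Suc)
    qed
    then have "(\<Sum>r\<le>n. real (n choose r) * (?c S r * ((sqrt (pi * s) * s ^ (n - r) * pochhammer (1 / 2) (n - r)) * ?P)))
      = (sqrt (pi * s) ^ Suc (card S) * s ^ n * ?P) * pochhammer (real (card S) / 2 + 1 / 2) n"
      unfolding pochhammer_binomial_sum sum_distrib_left by (intro sum.cong refl) (simp only: atMost_iff)
    also have "real (card S) / 2 + 1 / 2 = real (card (insert a S)) / 2"
      using insert.hyps by (simp add: add_divide_distrib)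
    finally show ?thesis using insert.hyps by (simp add: mult_ac)
  qed
  ultimately show ?case by simp
qed

lemma weight_power_expand:
  fixes k :: "real^'d::finite"
  shows "(1 + (norm k)\<^sup>2) ^ m = (\<Sum>l\<le>m. \<Sum>j\<le>l. real (m choose l) * real (l choose j) *
    ((k $ e) ^ (2 * j) * (\<Sum>i\<in>UNIV - {e}. (k $ i)\<^sup>2) ^ (l - j)))"
proof -
  have "(norm k)\<^sup>2 = (k $ e)\<^sup>2 + (\<Sum>i\<in>UNIV - {e}. (k $ i)\<^sup>2)"
    unfolding norm_vec_sq by (rule sum.remove) auto
  then have "((norm k)\<^sup>2) ^ l = (\<Sum>j\<le>l. real (l choose j) * ((k $ e)\<^sup>2) ^ j * (\<Sum>i\<in>UNIV - {e}. (k $ i)\<^sup>2) ^ (l - j))" for l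
    by (simp add: binomial_ring)
  moreover have "(1 + (norm k)\<^sup>2) ^ m = (\<Sum>l\<le>m. real (m choose l) * ((norm k)\<^sup>2) ^ l)"
    using binomial_ring[of "(norm k)\<^sup>2" 1 m] by (simp add: add.commute)
  ultimately show ?thesis
    by (simp add: sum_distrib_left power_mult mult.assoc)
qed

text \<open>
  In each term of the expanded weight, the coordinate \<open>e\<close> contributes a shifted normal moment and
  the remaining \<open>d - 1\<close> coordinates a centred radial moment. In dimension one the Pochhammer symbol
  at \<open>(d - 1) / 2 = 0\<close> correctly removes all terms with \<open>j < l\<close>.
\<close>

lemma H_norm_gauss_wave_nat:
  fixes e :: "'d::finite" and m :: nat
  assumes s: "0 < \<sigma>"
  defines "d \<equiv> CARD('d)"
  shows "(H_norm (real m) (gauss_wave e p \<sigma>))\<^sup>2 =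
    pi powr (d / 2) *
    (\<Sum>l=0..m. \<Sum>j=0..l. \<Sum>g=0..j.
       real (m choose l) * real (l choose j) * real ((2 * j) choose (2 * g)) *
       (real_of_int (dfact (2 * int g - 1)) / 2 ^ g) *
       pochhammer (real d / 2 - 1 / 2) (l - j) * p ^ (2 * j - 2 * g) *
       \<sigma> powr (real l + real g - real j - real d / 2))"
proof -
  let ?S = "UNIV - {e}"
  let ?M = "\<lambda>j. \<Sum>g\<le>j. real ((2 * j) choose (2 * g)) * p ^ (2 * j - 2 * g) * (\<sigma> ^ g * pochhammer (1/2) g)"
  let ?c = "sqrt (pi * \<sigma>)"
  have d: "1 \<le> d" using zero_less_card_finite[where 'a='d] unfolding d_def by linarith
  have coord_term: "has_bochner_integral lborel
      (\<lambda>k::real^'d. (k $ e) ^ (2 * j) * (\<Sum>i\<in>?S. (k $ i)\<^sup>2) ^ n * exp (- ((norm (k - p *\<^sub>R axis e 1))\<^sup>2 / \<sigma>)))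
      (?c ^ d * (\<sigma> ^ n * pochhammer (real d / 2 - 1 / 2) n * ?M j))" for j n
  proof -
    define g :: "'d \<Rightarrow> real \<Rightarrow> real" where
      "g = (\<lambda>_ t. exp (- (t\<^sup>2 / \<sigma>)))(e := \<lambda>t. t ^ (2 * j) * exp (- ((t - p)\<^sup>2 / \<sigma>)))"
    have ge: "has_bochner_integral lborel (g e) (?c * ?M j)"
      using gauss_moment_shifted[OF s, of j p] by (simp add: g_def)
    have A: "has_bochner_integral lborel (\<lambda>k::real^'d. (\<Sum>i\<in>?S. (k $ i)\<^sup>2) ^ n * (\<Prod>i\<in>UNIV. g i (k $ i)))
       (?c ^ card ?S * \<sigma> ^ n * pochhammer (real (card ?S) / 2) n * (\<Prod>i\<in>- ?S. integral\<^sup>L lborel (g i)))"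
      using integrable.intros[OF ge] by (intro gauss_partial_radius_moment s) (auto simp: g_def)
    have P: "(\<Prod>i\<in>- ?S. integral\<^sup>L lborel (g i)) = ?c * ?M j"
    proof -
      have "- ?S = {e}" by auto
      then show ?thesis using has_bochner_integral_integral_eq[OF ge] by simp
    qed
    have C: "real (card ?S) / 2 = real d / 2 - 1 / 2" "?c * ?c ^ card ?S = ?c ^ d"
    proof -
      have Suc: "Suc (card ?S) = d" using card_Suc_Diff1[of UNIV e] by (simp add: d_def)
      then have "real d = 1 + real (card ?S)" by (metis of_nat_Suc)
      then show "real (card ?S) / 2 = real d / 2 - 1 / 2" by linarith
      show "?c * ?c ^ card ?S = ?c ^ d" unfolding Suc[symmetric] by (rule power_Suc[symmetric])
    qed
    have I: "(\<Sum>i\<in>?S. (k $ i)\<^sup>2) ^ n * (\<Prod>i\<in>UNIV. g i (k $ i))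
      = (k $ e) ^ (2 * j) * (\<Sum>i\<in>?S. (k $ i)\<^sup>2) ^ n * exp (- ((norm (k - p *\<^sub>R axis e 1))\<^sup>2 / \<sigma>))" for k :: "real^'d"
    proof -
      have "(\<Prod>i\<in>UNIV. g i (k $ i)) = (\<Prod>i\<in>UNIV. (if i = e then (k $ e) ^ (2 * j) else 1) * exp (- (((k - p *\<^sub>R axis e 1) $ i)\<^sup>2 / \<sigma>)))"
        by (intro prod.cong) (auto simp: g_def axis_def)
      also have "\<dots> = (k $ e) ^ (2 * j) * exp (- ((norm (k - p *\<^sub>R axis e 1))\<^sup>2 / \<sigma>))"
        unfolding norm_vec_sq[of "k - p *\<^sub>R axis e 1"]
        by (simp add: prod.distrib exp_sum[symmetric] sum_negf sum_divide_distrib)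
      finally show ?thesis by simp
    qed
    have "?c ^ card ?S * \<sigma> ^ n * pochhammer (real (card ?S) / 2) n * (?c * ?M j)
      = ?c ^ d * (\<sigma> ^ n * pochhammer (real d / 2 - 1 / 2) n * ?M j)"
      unfolding C(1) C(2)[symmetric] by (simp only: mult_ac)
    then show ?thesis using A unfolding I P by (simp only:)
  qed
  have "has_bochner_integral lborel
    (\<lambda>k::real^'d. \<Sum>l\<le>m. \<Sum>j\<le>l. (real (m choose l) * real (l choose j)) *
      ((k $ e) ^ (2 * j) * (\<Sum>i\<in>?S. (k $ i)\<^sup>2) ^ (l - j) * exp (- ((norm (k - p *\<^sub>R axis e 1))\<^sup>2 / \<sigma>))))
    (\<Sum>l\<le>m. \<Sum>j\<le>l. (real (m choose l) * real (l choose j)) *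
      (?c ^ d * (\<sigma> ^ (l - j) * pochhammer (real d / 2 - 1 / 2) (l - j) * ?M j)))"
    by (intro has_bochner_integral_sum has_bochner_integral_mult_right coord_term)
  moreover have "(\<Sum>l\<le>m. \<Sum>j\<le>l. (real (m choose l) * real (l choose j)) *
      ((k $ e) ^ (2 * j) * (\<Sum>i\<in>?S. (k $ i)\<^sup>2) ^ (l - j) * exp (- ((norm (k - p *\<^sub>R axis e 1))\<^sup>2 / \<sigma>))))
    = (1 + (norm k)\<^sup>2) powr real m * exp (- ((norm (k - p *\<^sub>R axis e 1))\<^sup>2 / \<sigma>))" for k :: "real^'d"
  proof -
    have "(1 + (norm k)\<^sup>2) powr real m = (1 + (norm k)\<^sup>2) ^ m"
      by (rule powr_realpow) (simp add: add_pos_nonneg)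
    then show ?thesis
      unfolding weight_power_expand[of k m e] by (simp add: sum_distrib_right mult.assoc)
  qed
  ultimately have "(H_norm (real m) (gauss_wave e p \<sigma>))\<^sup>2 = (\<Sum>l\<le>m. \<Sum>j\<le>l. (real (m choose l) * real (l choose j)) *
      (?c ^ d * (\<sigma> ^ (l - j) * pochhammer (real d / 2 - 1 / 2) (l - j) * ?M j))) / \<sigma> ^ d"
    unfolding H_norm_gauss_wave[OF of_nat_0_le_iff s] d_def[symmetric]
    by (simp add: has_bochner_integral_iff)
  also have "\<dots> = (\<Sum>l\<le>m. \<Sum>j\<le>l. \<Sum>g\<le>j. pi powr (d / 2) * (real (m choose l) * real (l choose j) * real ((2 * j) choose (2 * g)) *
       (real_of_int (dfact (2 * int g - 1)) / 2 ^ g) *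
       pochhammer (real d / 2 - 1 / 2) (l - j) * p ^ (2 * j - 2 * g) *
       \<sigma> powr (real l + real g - real j - real d / 2)))"
    unfolding sum_divide_distrib
  proof (intro sum.cong refl)
    fix l j :: nat assume "j \<in> {..l}"
    then have lj: "j \<le> l" by simp
    have cd: "?c ^ d / \<sigma> ^ d = pi powr (d / 2) * \<sigma> powr (- (real d / 2))"
    proof -
      have "?c ^ d = pi powr (d / 2) * \<sigma> powr (d / 2)"
        using s by (simp add: powr_half_sqrt[symmetric] powr_powr powr_mult flip: powr_realpow)
      moreover have "\<sigma> ^ d = \<sigma> powr (d / 2) * \<sigma> powr (d / 2)"
        using s by (simp flip: powr_add powr_realpow)
      ultimately show ?thesis using s by (simp add: powr_minus_divide)
    qed
    have pw: "\<sigma> powr (real l + real g - real j - real d / 2) = \<sigma> powr (- (real d / 2)) * (\<sigma> ^ (l - j) * \<sigma> ^ g)" for g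
    proof -
      have "real l + real g - real j - real d / 2 = - (real d / 2) + (real (l - j) + real g)"
        using lj by (simp add: of_nat_diff)
      then show ?thesis using s by (simp only: powr_add powr_realpow)
    qed
    have "real (m choose l) * real (l choose j) * (?c ^ d * (\<sigma> ^ (l - j) * pochhammer (real d / 2 - 1 / 2) (l - j) * ?M j)) / \<sigma> ^ d
      = (?c ^ d / \<sigma> ^ d) * (real (m choose l) * real (l choose j) * (\<sigma> ^ (l - j) * pochhammer (real d / 2 - 1 / 2) (l - j) * ?M j))"
      by simp
    also have "\<dots> = (\<Sum>g\<le>j. pi powr (d / 2) * (real (m choose l) * real (l choose j) * real ((2 * j) choose (2 * g)) *
       pochhammer (1/2) g *
       pochhammer (real d / 2 - 1 / 2) (l - j) * p ^ (2 * j - 2 * g) *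
       \<sigma> powr (real l + real g - real j - real d / 2)))"
      unfolding cd pw sum_distrib_left by (intro sum.cong refl) (simp only: mult_ac)
    finally show "real (m choose l) * real (l choose j) * (?c ^ d * (\<sigma> ^ (l - j) * pochhammer (real d / 2 - 1 / 2) (l - j) * ?M j)) / \<sigma> ^ d
      = (\<Sum>g\<le>j. pi powr (d / 2) * (real (m choose l) * real (l choose j) * real ((2 * j) choose (2 * g)) *
       (real_of_int (dfact (2 * int g - 1)) / 2 ^ g) *
       pochhammer (real d / 2 - 1 / 2) (l - j) * p ^ (2 * j - 2 * g) *
       \<sigma> powr (real l + real g - real j - real d / 2)))"
      unfolding dfact_odd .
  qed
  finally show ?thesis
    by (simp only: sum_distrib_left atLeast0AtMost)
qed

section \<open>The lower bound for the sharp constant\<close>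

text \<open>
  Apply the inequality that defines an admissible constant to two trial functions and use that
  their product is a trial function. If no constant is admissible, the infimum is \<open>\<infinity>\<close>.
\<close>

lemma KF_le_sharp_const:
  fixes e :: "'d::finite"
  assumes m: "0 \<le> m" and n: "0 \<le> n" and s: "0 < \<sigma>" "0 < \<tau>"
  shows "ereal (KF e l m n p q \<sigma> \<tau>) \<le> sharp_const TYPE('d) l m n"
  unfolding sharp_const_def
proof (rule INF_greatest)
  fix K assume K: "K \<in> admissible_consts TYPE('d) l m n"
  let ?f = "gauss_wave e p \<sigma>" and ?g = "gauss_wave e q \<tau>"
  let ?a = "H_norm m ?f * H_norm n ?g"
  have "H_norm l (\<lambda>x. ?f x * ?g x) \<le> K * H_norm m ?f * H_norm n ?g"
    using K gauss_wave_sobolev_fun[OF m s(1)] gauss_wave_sobolev_fun[OF n s(2)]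
    unfolding admissible_consts_def by blast
  then have le: "H_norm l (gauss_wave e (p + q) (\<sigma> + \<tau>)) \<le> K * ?a"
    unfolding gauss_wave_mult by (simp add: mult.assoc)
  have K0: "0 \<le> K" using K by (simp add: admissible_consts_def)
  have "KF e l m n p q \<sigma> \<tau> \<le> K"
  \<comment> \<open>A vanishing denominator is harmless, since \<^const>\<open>KF\<close> is then zero.\<close>
  proof (cases "?a = 0")
    case True
    show ?thesis using K0 unfolding KF_def True by simp
  next
    case False
    then have "0 < ?a" using sobolev_norm_nonneg by (metis less_eq_real_def mult_nonneg_nonneg)
    then show ?thesis using le unfolding KF_def by (simp add: pos_divide_le_eq)
  qed
  then show "ereal (KF e l m n p q \<sigma> \<tau>) \<le> ereal K" by simp
qed

theorem proposition2p6:
  fixes e :: "'d::finite" and d :: nat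
  assumes "d = CARD('d)"
  shows
    \<comment> \<open>(i)\<close>
    "(\<forall>(m::real) (p::real) (\<sigma>::real). 0 \<le> m \<and> 0 \<le> p \<and> 0 < \<sigma> \<longrightarrow>
        gauss_wave e p \<sigma> \<in> sobolev_fun m \<and>
        (0 < p \<longrightarrow>
          (H_norm m (gauss_wave e p \<sigma>))\<^sup>2 =
            2 * pi powr (d / 2) / (\<sigma> powr (d / 2 + 1) * p powr (d / 2 - 1)) *
            (LBINT \<rho>:{0..}. \<rho> powr (d / 2) * (1 + \<rho>\<^sup>2) powr m * exp (- ((\<rho>\<^sup>2 + p\<^sup>2) / \<sigma>)) *
               bessel_I (d / 2 - 1) (2 * p / \<sigma> * \<rho>))))
     \<and> (\<forall>(m::real) (\<sigma>::real). 0 \<le> m \<and> 0 < \<sigma> \<longrightarrow>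
        (H_norm m (gauss_wave e 0 \<sigma>))\<^sup>2 =
          2 * pi powr (d / 2) / (Gamma (d / 2) * \<sigma> ^ d) *
          (LBINT \<rho>:{0..}. \<rho> ^ (d - 1) * (1 + \<rho>\<^sup>2) powr m * exp (- (\<rho>\<^sup>2 / \<sigma>))))
     \<and> (\<forall>(m::real) (\<sigma>::real). 0 \<le> m \<and> 0 < \<sigma> \<longrightarrow>
        ((\<lambda>p. 2 * pi powr (d / 2) / (\<sigma> powr (d / 2 + 1) * p powr (d / 2 - 1)) *
            (LBINT \<rho>:{0..}. \<rho> powr (d / 2) * (1 + \<rho>\<^sup>2) powr m * exp (- ((\<rho>\<^sup>2 + p\<^sup>2) / \<sigma>)) *
               bessel_I (d / 2 - 1) (2 * p / \<sigma> * \<rho>)))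
         \<longlongrightarrow> 2 * pi powr (d / 2) / (Gamma (d / 2) * \<sigma> ^ d) *
            (LBINT \<rho>:{0..}. \<rho> ^ (d - 1) * (1 + \<rho>\<^sup>2) powr m * exp (- (\<rho>\<^sup>2 / \<sigma>))))
        (at_right 0))
     \<and> bessel_I (d / 2 - 1) \<sim>[at_right 0] (\<lambda>w. (w / 2) powr (d / 2 - 1) / Gamma (d / 2))
     \<and> (\<forall>(m::nat) (p::real) (\<sigma>::real). 0 \<le> p \<and> 0 < \<sigma> \<longrightarrow>
        (H_norm (real m) (gauss_wave e p \<sigma>))\<^sup>2 =
          pi powr (d / 2) *
          (\<Sum>l=0..m. \<Sum>j=0..l. \<Sum>g=0..j.
             real (m choose l) * real (l choose j) * real ((2 * j) choose (2 * g)) *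
             (real_of_int (dfact (2 * int g - 1)) / 2 ^ g) *
             pochhammer (real d / 2 - 1 / 2) (l - j) * p ^ (2 * j - 2 * g) *
             \<sigma> powr (real l + real g - real j - real d / 2)))
    \<comment> \<open>(ii)\<close>
     \<and> (\<forall>(l::real) (m::real) (n::real).
        0 \<le> l \<and> l \<le> m \<and> m \<le> n \<and> m + n - l > real d / 2 \<longrightarrow>
        (\<forall>p\<ge>0. \<forall>q\<ge>0. \<forall>\<sigma>>0. \<forall>\<tau>>0. sharp_const TYPE('d) l m n \<ge> ereal (KF e l m n p q \<sigma> \<tau>)) \<and>
        sharp_const TYPE('d) l m n \<ge>
          (SUP (p, q, \<sigma>, \<tau>) \<in> {0..} \<times> {0..} \<times> {0<..} \<times> {0<..}. ereal (KF e l m n p q \<sigma> \<tau>)))"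
proof -
  have d0: "0 < d" using assms by simp
  have \<nu>: "- 1 / 2 \<le> real d / 2 - 1" using d0 by (cases d) auto
  have limit: "((\<lambda>p. 2 * pi powr (d / 2) / (\<sigma> powr (d / 2 + 1) * p powr (d / 2 - 1)) *
          (LBINT \<rho>:{0..}. \<rho> powr (d / 2) * (1 + \<rho>\<^sup>2) powr m * exp (- ((\<rho>\<^sup>2 + p\<^sup>2) / \<sigma>)) *
             bessel_I (d / 2 - 1) (2 * p / \<sigma> * \<rho>)))
       \<longlongrightarrow> (H_norm m (gauss_wave e 0 \<sigma>))\<^sup>2) (at_right 0)" if "0 \<le> m" "0 < \<sigma>" for m \<sigma>
  proof (rule Lim_transform_eventually[OF H_norm_gauss_wave_tendsto[OF that, of e]])
    show "\<forall>\<^sub>F p in at_right 0. (H_norm m (gauss_wave e p \<sigma>))\<^sup>2 =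
        2 * pi powr (d / 2) / (\<sigma> powr (d / 2 + 1) * p powr (d / 2 - 1)) *
          (LBINT \<rho>:{0..}. \<rho> powr (d / 2) * (1 + \<rho>\<^sup>2) powr m * exp (- ((\<rho>\<^sup>2 + p\<^sup>2) / \<sigma>)) *
             bessel_I (d / 2 - 1) (2 * p / \<sigma> * \<rho>))"
      using eventually_at_right_less[of "0::real"]
      by eventually_elim (unfold assms, rule H_norm_gauss_wave_bessel[OF that])
  qed
  have KF: "ereal (KF e l m n p q \<sigma> \<tau>) \<le> sharp_const TYPE('d) l m n"
    if "0 \<le> l \<and> l \<le> m \<and> m \<le> n \<and> m + n - l > real d / 2" "0 < \<sigma>" "0 < \<tau>" for l m n p q \<sigma> \<tau>
    using that by (intro KF_le_sharp_const) auto
  show ?thesis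
  proof (intro conjI allI impI)
    fix m p \<sigma> :: real assume a: "0 \<le> m \<and> 0 \<le> p \<and> 0 < \<sigma>"
    then show "gauss_wave e p \<sigma> \<in> sobolev_fun m" by (intro gauss_wave_sobolev_fun) auto
    assume "0 < p"
    with a show "(H_norm m (gauss_wave e p \<sigma>))\<^sup>2 =
            2 * pi powr (d / 2) / (\<sigma> powr (d / 2 + 1) * p powr (d / 2 - 1)) *
            (LBINT \<rho>:{0..}. \<rho> powr (d / 2) * (1 + \<rho>\<^sup>2) powr m * exp (- ((\<rho>\<^sup>2 + p\<^sup>2) / \<sigma>)) *
               bessel_I (d / 2 - 1) (2 * p / \<sigma> * \<rho>))"
      unfolding assms by (intro H_norm_gauss_wave_bessel) auto
  next
    fix m \<sigma> :: real assume "0 \<le> m \<and> 0 < \<sigma>"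
    then have a: "0 \<le> m" "0 < \<sigma>" by auto
    show norm0: "(H_norm m (gauss_wave e 0 \<sigma>))\<^sup>2 =
          2 * pi powr (d / 2) / (Gamma (d / 2) * \<sigma> ^ d) *
          (LBINT \<rho>:{0..}. \<rho> ^ (d - 1) * (1 + \<rho>\<^sup>2) powr m * exp (- (\<rho>\<^sup>2 / \<sigma>)))"
      unfolding assms by (rule H_norm_gauss_wave_0[OF a])
    show "((\<lambda>p. 2 * pi powr (d / 2) / (\<sigma> powr (d / 2 + 1) * p powr (d / 2 - 1)) *
            (LBINT \<rho>:{0..}. \<rho> powr (d / 2) * (1 + \<rho>\<^sup>2) powr m * exp (- ((\<rho>\<^sup>2 + p\<^sup>2) / \<sigma>)) *
               bessel_I (d / 2 - 1) (2 * p / \<sigma> * \<rho>)))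
         \<longlongrightarrow> 2 * pi powr (d / 2) / (Gamma (d / 2) * \<sigma> ^ d) *
            (LBINT \<rho>:{0..}. \<rho> ^ (d - 1) * (1 + \<rho>\<^sup>2) powr m * exp (- (\<rho>\<^sup>2 / \<sigma>))))
        (at_right 0)"
      unfolding norm0[symmetric] by (rule limit[OF a])
  next
    show "bessel_I (d / 2 - 1) \<sim>[at_right 0] (\<lambda>w. (w / 2) powr (d / 2 - 1) / Gamma (d / 2))"
      using bessel_I_asymp_equiv[OF \<nu>] by simp
  next
    fix m :: nat and p \<sigma> :: real assume "0 \<le> p \<and> 0 < \<sigma>"
    then show "(H_norm (real m) (gauss_wave e p \<sigma>))\<^sup>2 =
          pi powr (d / 2) *
          (\<Sum>l=0..m. \<Sum>j=0..l. \<Sum>g=0..j.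
             real (m choose l) * real (l choose j) * real ((2 * j) choose (2 * g)) *
             (real_of_int (dfact (2 * int g - 1)) / 2 ^ g) *
             pochhammer (real d / 2 - 1 / 2) (l - j) * p ^ (2 * j - 2 * g) *
             \<sigma> powr (real l + real g - real j - real d / 2))"
      unfolding assms by (intro H_norm_gauss_wave_nat) auto
  next
    fix l m n :: real assume lmn: "0 \<le> l \<and> l \<le> m \<and> m \<le> n \<and> m + n - l > real d / 2"
    show "ereal (KF e l m n p q \<sigma> \<tau>) \<le> sharp_const TYPE('d) l m n" if "0 < \<sigma>" "0 < \<tau>" for p q \<sigma> \<tau>
      using that by (rule KF[OF lmn])
    show "(SUP (p, q, \<sigma>, \<tau>) \<in> {0..} \<times> {0..} \<times> {0<..} \<times> {0<..}. ereal (KF e l m n p q \<sigma> \<tau>)) \<le> sharp_const TYPE('d) l m n"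
      by (rule SUP_least) (auto intro!: KF[OF lmn])
  qed
qed

end
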